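(* Let $\mathbb{D},\mathbb{D}'$ be division rings with $|\mathbb{D}|\ge 4$, and let $m,n,m',n'\ge 2$ be integers with $m',n'\ge\min\{m,n\}$. Suppose $\varphi:\mathbb{D}^{m\times n}\to\mathbb{D}'^{m'\times n'}$ is a degenerate graph homomorphism with $\varphi(0)=0$, and there exists $A_0\in\mathbb{D}^{m\times n}$ such that $\mathrm{rank}(\varphi(A_0))=\min\{m,n\}$. Then $\varphi(\mathbb{D}^{m\times n}_{\le 1})$ and $\varphi(\mathbb{B}_{A_0})$ are both adjacent sets.
   Context: For a division ring $\mathbb{D}$, matrices $A,B\in\mathbb{D}^{m\times n}$ are adjacent, written $A\sim B$, if $\mathrm{rank}(A-B)=1$. A map $\varphi:\mathbb{D}^{m\times n}\to\mathbb{D}'^{m'\times n'}$ is a graph homomorphism if $A\sim B$ implies $\varphi(A)\sim\varphi(B)$. An adjacent set is a nonempty set of matrices any two distinct members of which are adjacent; a maximal set is an adjacent set not properly contained in any other adjacent set. Let $\mathcal{M}_1\subset\mathbb{D}^{m\times n}$ be the set of matrices supported in the first row and $\mathcal{N}_1$ the set of matrices supported in the first column. For $m,n\ge2$, every maximal set of $\mathbb{D}^{m\times n}$ is either of type one, i.e. of the form $P\mathcal{M}_1+A$ with $P\in GL_m(\mathbb{D})$, $A\in\mathbb{D}^{m\times n}$, or of type two, i.e. of the form $\mathcal{N}_1Q+A$ with $Q\in GL_n(\mathbb{D})$, $A\in\mathbb{D}^{m\times n}$ (and likewise over $\mathbb{D}'$). $\mathbb{D}^{m\times n}_{\le 1}=\{X\in\mathbb{D}^{m\times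 n}:\mathrm{rank}(X)\le 1\}$, and $\mathbb{B}_A=\mathbb{D}^{m\times n}_{\le 1}+A$. A graph homomorphism $\varphi:\mathbb{D}^{m\times n}\to\mathbb{D}'^{m'\times n'}$ is degenerate if there exist a matrix $A\in\mathbb{D}^{m\times n}_{\le 1}$ and two maximal sets $\mathcal{M},\mathcal{N}$ of different types in $\mathbb{D}'^{m'\times n'}$ such that $\varphi(\mathbb{B}_A)\subseteq\mathcal{M}\cup\mathcal{N}$ and $\varphi(A)\in\mathcal{M}\cap\mathcal{N}$. *)

theory Defs
  imports "Jordan_Normal_Form.Matrix"
begin

text \<open>
  The libraries develop linear algebra over fields only.  Over a division ring the rank of a matrix
  is the dimension of its left row space (equivalently, of its right column space), so scalars
  multiply rows from the left throughout.
\<close>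

definition left_lincomb :: "nat \<Rightarrow> ('a::division_ring vec \<Rightarrow> 'a) \<Rightarrow> 'a vec set \<Rightarrow> 'a vec" where
  "left_lincomb n c B = vec n (\<lambda>j. \<Sum>b\<in>B. c b * b $ j)"

definition left_span :: "nat \<Rightarrow> 'a::division_ring vec set \<Rightarrow> 'a vec set" where
  "left_span n S = {left_lincomb n c B | c B. finite B \<and> B \<subseteq> S}"

definition left_basis :: "nat \<Rightarrow> 'a::division_ring vec set \<Rightarrow> 'a vec set \<Rightarrow> bool" where
  "left_basis n B V \<longleftrightarrow>
     finite B \<and> B \<subseteq> carrier_vec n \<and>
     (\<forall>c. left_lincomb n c B = 0\<^sub>v n \<longrightarrow> (\<forall>b\<in>B. c b = 0)) \<and>
     left_span n B = V"

text \<open>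
  Meaningful for left subspaces \<open>V\<close> of the row vectors of length \<open>n\<close>; these have finite bases, all
  of the same cardinality.
\<close>
definition left_dim :: "nat \<Rightarrow> 'a::division_ring vec set \<Rightarrow> nat" where
  "left_dim n V = card (SOME B. left_basis n B V)"

definition mat_rank :: "'a::division_ring mat \<Rightarrow> nat" where
  "mat_rank A = left_dim (dim_col A) (left_span (dim_col A) (set (rows A)))"

definition adjacent :: "'a::division_ring mat \<Rightarrow> 'a mat \<Rightarrow> bool" where
  "adjacent A B \<longleftrightarrow> mat_rank (A - B) = 1"

definition graph_hom ::
    "nat \<Rightarrow> nat \<Rightarrow> nat \<Rightarrow> nat \<Rightarrow> ('a::division_ring mat \<Rightarrow> 'b::division_ring mat) \<Rightarrow> bool" where
  "graph_hom m n m' n' \<phi> \<longleftrightarrow>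
     (\<forall>A\<in>carrier_mat m n. \<phi> A \<in> carrier_mat m' n') \<and>
     (\<forall>A\<in>carrier_mat m n. \<forall>B\<in>carrier_mat m n. adjacent A B \<longrightarrow> adjacent (\<phi> A) (\<phi> B))"

definition adjacent_set :: "nat \<Rightarrow> nat \<Rightarrow> 'a::division_ring mat set \<Rightarrow> bool" where
  "adjacent_set m n S \<longleftrightarrow>
     S \<noteq> {} \<and> S \<subseteq> carrier_mat m n \<and> (\<forall>A\<in>S. \<forall>B\<in>S. A \<noteq> B \<longrightarrow> adjacent A B)"

definition maximal_set :: "nat \<Rightarrow> nat \<Rightarrow> 'a::division_ring mat set \<Rightarrow> bool" where
  "maximal_set m n S \<longleftrightarrow> adjacent_set m n S \<and> \<not> (\<exists>T. adjacent_set m n T \<and> S \<subset> T)"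

text \<open>Indices start at 0, so the first row and the first column have index 0.\<close>
definition first_row_mats :: "nat \<Rightarrow> nat \<Rightarrow> 'a::division_ring mat set" where
  "first_row_mats m n = {X \<in> carrier_mat m n. \<forall>i<m. \<forall>j<n. i \<noteq> 0 \<longrightarrow> X $$ (i, j) = 0}"

definition first_col_mats :: "nat \<Rightarrow> nat \<Rightarrow> 'a::division_ring mat set" where
  "first_col_mats m n = {X \<in> carrier_mat m n. \<forall>i<m. \<forall>j<n. j \<noteq> 0 \<longrightarrow> X $$ (i, j) = 0}"

definition GL :: "nat \<Rightarrow> 'a::division_ring mat set" where
  "GL n = {P \<in> carrier_mat n n. invertible_mat P}"

definition type_one :: "nat \<Rightarrow> nat \<Rightarrow> 'a::division_ring mat set \<Rightarrow> bool" where
  "type_one m n S \<longleftrightarrow> maximal_set m n S \<and>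
     (\<exists>P\<in>GL m. \<exists>A\<in>carrier_mat m n. S = {P * X + A | X. X \<in> first_row_mats m n})"

definition type_two :: "nat \<Rightarrow> nat \<Rightarrow> 'a::division_ring mat set \<Rightarrow> bool" where
  "type_two m n S \<longleftrightarrow> maximal_set m n S \<and>
     (\<exists>Q\<in>GL n. \<exists>A\<in>carrier_mat m n. S = {X * Q + A | X. X \<in> first_col_mats m n})"

definition rank_le_one :: "nat \<Rightarrow> nat \<Rightarrow> 'a::division_ring mat set" where
  "rank_le_one m n = {X \<in> carrier_mat m n. mat_rank X \<le> 1}"

definition unit_ball :: "nat \<Rightarrow> nat \<Rightarrow> 'a::division_ring mat \<Rightarrow> 'a mat set" where
  "unit_ball m n A = {X + A | X. X \<in> rank_le_one m n}"

definition degenerate ::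
    "nat \<Rightarrow> nat \<Rightarrow> nat \<Rightarrow> nat \<Rightarrow> ('a::division_ring mat \<Rightarrow> 'b::division_ring mat) \<Rightarrow> bool" where
  "degenerate m n m' n' \<phi> \<longleftrightarrow>
     (\<exists>A\<in>rank_le_one m n. \<exists>M N.
        (type_one m' n' M \<and> type_two m' n' N \<or> type_two m' n' M \<and> type_one m' n' N) \<and>
        \<phi> ` unit_ball m n A \<subseteq> M \<union> N \<and> \<phi> A \<in> M \<inter> N)"

end

theory Submission
  imports Defs
begin

text \<open>
  Call \<open>\<phi>\<close> collapsing at \<open>A\<close> if the image of the unit ball at \<open>A\<close> lies in \<open>M \<union> N\<close> for two maximal sets
  of different types through \<open>\<phi> A\<close>; then every maximal set through \<open>A\<close> goes to \<open>M\<close> or to \<open>N\<close>.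
  Collapsing passes from \<open>A\<close> to any neighbour \<open>B\<close>: if the two maximal sets through \<open>A\<close> and \<open>B\<close> go to
  the same set \<open>M\<close>, any maximal set through \<open>B\<close> not going to \<open>M\<close> determines the set \<open>N\<close>
  for \<open>B\<close>; if they go to different sets, no \<open>X\<close> adjacent to \<open>B\<close> can have
  \<open>rank (\<phi> X - \<phi> A) = 2\<close>, so the same \<open>M\<close> and \<open>N\<close> serve for \<open>B\<close>. Hence a degenerate \<open>\<phi>\<close> is collapsing
  at every point. If moreover some \<open>\<phi> C\<close> has distance \<open>min m n\<close> from \<open>\<phi> A\<close>, then any two maximal sets
  through \<open>A\<close> of one type (rows if \<open>m \<le> n\<close>, columns otherwise) are linked by some \<open>X\<close> with
  \<open>rank (\<phi> X - \<phi> A) = 2\<close>, and this forces all of them into the same one of \<open>M\<close>, \<open>N\<close>. Apply this to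
  \<open>(A, C) = (0, A\<^sub>0)\<close> and \<open>(A\<^sub>0, 0)\<close>.
\<close>

section \<open>Rank over a division ring\<close>

text \<open>Gaussian elimination, by induction on the number \<open>k\<close> of columns: a row with
  nonzero entry in the last column clears that column from the other rows. All coefficients stay on
  the left.\<close>

lemma nontrivial_left_relation:
  fixes f :: "'b \<Rightarrow> nat \<Rightarrow> 'a::division_ring"
  assumes "finite B" and "k < card B"
  shows "\<exists>c. (\<exists>b\<in>B. c b \<noteq> 0) \<and> (\<forall>l<k. (\<Sum>b\<in>B. c b * f b l) = 0)"
  using assms
proof (induction k arbitrary: B f)
  case 0
  then obtain b where "b \<in> B" by fastforce
  then show ?case by (intro exI[of _ "\<lambda>_. 1"]) auto
next
  case (Suc k)
  show ?case
  proof (cases "\<forall>b\<in>B. f b k = 0")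
    case True
    obtain c where c: "\<exists>b\<in>B. c b \<noteq> 0" "\<forall>l<k. (\<Sum>b\<in>B. c b * f b l) = 0"
      using Suc.IH[of B f] Suc.prems by auto
    have "(\<Sum>b\<in>B. c b * f b l) = 0" if "l < Suc k" for l
      using that c(2) True by (cases "l = k") auto
    with c(1) show ?thesis by blast
  next
    case False
    then obtain b0 where b0: "b0 \<in> B" "f b0 k \<noteq> 0" by blast
    define B' where "B' = B - {b0}"
    have B': "finite B'" "k < card B'" "B = insert b0 B'" "b0 \<notin> B'"
      using Suc.prems b0 by (auto simp: B'_def)
    obtain c where c: "\<exists>b\<in>B'. c b \<noteq> 0"
      "\<forall>l<k. (\<Sum>b\<in>B'. c b * (f b l - f b k * inverse (f b0 k) * f b0 l)) = 0"
      using Suc.IH[OF B'(1,2), of "\<lambda>b l. f b l - f b k * inverse (f b0 k) * f b0 l"] by blast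
    \<comment> \<open>\<open>t\<close> is the total multiple of row \<open>b0\<close> subtracted in
      the elimination. Giving \<open>b0\<close> the weight \<open>- t\<close> turns the relation
      between the reduced rows into one between the original rows.\<close>
    define t where "t = (\<Sum>b\<in>B'. c b * (f b k * inverse (f b0 k)))"
    define c' where "c' = c(b0 := - t)"
    have sum_c': "(\<Sum>b\<in>B. c' b * f b l) = (\<Sum>b\<in>B'. c b * f b l) - t * f b0 l" for l
    proof -
      have "(\<Sum>b\<in>B'. c' b * f b l) = (\<Sum>b\<in>B'. c b * f b l)"
        using B'(4) by (intro sum.cong) (auto simp: c'_def)
      then show ?thesis
        using B' by (simp add: c'_def)
    qed
    have split: "(\<Sum>b\<in>B'. c b * (f b l - f b k * inverse (f b0 k) * f b0 l))
        = (\<Sum>b\<in>B'. c b * f b l) - t * f b0 l" for l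
      by (simp add: t_def sum_distrib_right right_diff_distrib sum_subtractf mult.assoc)
    have "(\<Sum>b\<in>B. c' b * f b l) = 0" if "l < Suc k" for l
    proof (cases "l = k")
      case True
      have "t * f b0 k = (\<Sum>b\<in>B'. c b * f b k)"
        using b0(2) by (simp add: t_def sum_distrib_right mult.assoc)
      with True show ?thesis by (simp add: sum_c')
    next
      case False
      with that c(2) have "(\<Sum>b\<in>B'. c b * (f b l - f b k * inverse (f b0 k) * f b0 l)) = 0"
        by auto
      then show ?thesis by (simp add: sum_c' split)
    qed
    moreover have "\<exists>b\<in>B. c' b \<noteq> 0"
      using c(1) B'(3,4) by (auto simp: c'_def)
    ultimately show ?thesis by blast
  qed
qed

section \<open>Left spans and bases\<close>

lemma left_lincomb_index: "j < n \<Longrightarrow> left_lincomb n c B $ j = (\<Sum>b\<in>B. c b * b $ j)"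
  by (simp add: left_lincomb_def)

lemma left_span_mono: "S \<subseteq> T \<Longrightarrow> left_span n S \<subseteq> left_span n T"
  by (auto simp: left_span_def)

text \<open>Coefficients on a subset can be padded with zeros, so one coefficient function on all of
  \<open>S\<close> suffices.\<close>

lemma left_span_finite:
  fixes S :: "'a::division_ring vec set"
  assumes "finite S"
  shows "left_span n S = {left_lincomb n c S | c. True}"
proof
  show "left_span n S \<subseteq> {left_lincomb n c S | c. True}"
  proof
    fix x assume "x \<in> left_span n S"
    then obtain c B where x: "x = left_lincomb n c B" "B \<subseteq> S" by (auto simp: left_span_def)
    have "(\<Sum>b\<in>B. c b * b $ j) = (\<Sum>b\<in>S. (if b \<in> B then c b else 0) * b $ j)" for j
      using assms x(2) by (intro sum.mono_neutral_cong_left) auto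
    then have "x = left_lincomb n (\<lambda>b. if b \<in> B then c b else 0) S"
      by (simp add: x(1) left_lincomb_def)
    then show "x \<in> {left_lincomb n c S | c. True}" by blast
  qed
qed (use assms in \<open>auto simp: left_span_def\<close>)

lemma left_span_superset:
  assumes "b \<in> S" and "b \<in> carrier_vec n"
  shows "b \<in> left_span n S"
proof -
  have "left_lincomb n (\<lambda>_. 1) {b} = b"
    using assms(2) by (intro eq_vecI) (auto simp: left_lincomb_def)
  then show ?thesis
    using assms(1) unfolding left_span_def
    by (auto intro!: exI[of _ "\<lambda>_. 1"] exI[of _ "{b}"])
qed

lemma left_span_delete:
  fixes B :: "'a::division_ring vec set"
  assumes "finite B" and "left_lincomb n c B = 0\<^sub>v n" and "b0 \<in> B" and "c b0 \<noteq> 0"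
  shows "left_span n (B - {b0}) = left_span n B"
proof
  show "left_span n B \<subseteq> left_span n (B - {b0})"
  proof
    fix x assume "x \<in> left_span n B"
    then obtain d where x: "x = left_lincomb n d B"
      using left_span_finite[OF assms(1)] by auto
    \<comment> \<open>Subtracting this multiple of the vanishing combination \<open>c\<close> makes
      the coefficient of \<open>b0\<close> zero.\<close>
    define e where "e b = d b - d b0 * inverse (c b0) * c b" for b
    have "(\<Sum>b\<in>B. d b * b $ j) = (\<Sum>b\<in>B - {b0}. e b * b $ j)" if "j < n" for j
    proof -
      have c0: "(\<Sum>b\<in>B. c b * b $ j) = 0"
        using assms(2) that left_lincomb_index[of j n c B] by simp
      have "(\<Sum>b\<in>B. e b * b $ j)
          = (\<Sum>b\<in>B. d b * b $ j) - d b0 * inverse (c b0) * (\<Sum>b\<in>B. c b * b $ j)"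
        by (simp add: e_def left_diff_distrib sum_subtractf sum_distrib_left mult.assoc)
      moreover have "(\<Sum>b\<in>B. e b * b $ j) = (\<Sum>b\<in>B - {b0}. e b * b $ j)"
        using assms(1,3,4) by (subst sum.remove[of _ b0]) (auto simp: e_def mult.assoc)
      ultimately show ?thesis using c0 by simp
    qed
    then have "x = left_lincomb n e (B - {b0})"
      unfolding x left_lincomb_def by (intro eq_vecI) auto
    then show "x \<in> left_span n (B - {b0})"
      using left_span_finite[of "B - {b0}"] assms(1) by auto
  qed
qed (intro left_span_mono; blast)

text \<open>A spanning subset of \<open>S\<close> of least cardinality is independent, since a
  nontrivial relation would allow one vector to be dropped.\<close>

lemma left_basis_exists:
  fixes S :: "'a::division_ring vec set"
  assumes "finite S" and "S \<subseteq> carrier_vec n"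
  shows "\<exists>B. left_basis n B (left_span n S)"
proof -
  obtain B where B: "B \<subseteq> S" "left_span n B = left_span n S"
    and min: "\<And>B'. B' \<subseteq> S \<Longrightarrow> left_span n B' = left_span n S \<Longrightarrow> card B \<le> card B'"
    using ex_has_least_nat[of "\<lambda>B. B \<subseteq> S \<and> left_span n B = left_span n S" S card] by auto
  have fin: "finite B" using B(1) assms(1) finite_subset by blast
  have "c b = 0" if c: "left_lincomb n c B = 0\<^sub>v n" and b: "b \<in> B" for c b
  proof (rule ccontr)
    assume "c b \<noteq> 0"
    from left_span_delete[OF fin c b this] have "card B \<le> card (B - {b})"
      using min[of "B - {b}"] B by auto
    with b fin show False by (meson card_Diff1_less not_less)
  qed
  then have "left_basis n B (left_span n S)"
    using fin B assms(2) unfolding left_basis_def by auto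
  then show ?thesis ..
qed

text \<open>Ensures that the choice in \<open>left_dim\<close> picks an actual basis of the row
  space.\<close>

lemma mat_rank_basis:
  fixes A :: "'a::division_ring mat"
  assumes "A \<in> carrier_mat m n"
  obtains B where "left_basis n B (left_span n (set (rows A)))" and "mat_rank A = card B"
proof -
  have "set (rows A) \<subseteq> carrier_vec n"
    using assms by (auto simp: rows_def)
  from someI_ex[OF left_basis_exists[OF _ this]] show ?thesis
    using that assms by (auto simp: mat_rank_def left_dim_def)
qed

text \<open>Every row, hence every vector of a basis of the row space, is a left combination of the
  \<open>k\<close> vectors \<open>v l\<close>. More than \<open>k\<close> such vectors satisfy a
  nontrivial left relation.\<close>

lemma mat_rank_le:
  fixes A :: "'a::division_ring mat"
  assumes A: "A \<in> carrier_mat m n"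
    and sum: "\<And>i j. i < m \<Longrightarrow> j < n \<Longrightarrow> A $$ (i, j) = (\<Sum>l<k. u l i * v l j)"
  shows "mat_rank A \<le> k"
proof (rule ccontr)
  assume "\<not> mat_rank A \<le> k"
  with mat_rank_basis[OF A] obtain B
    where B: "left_basis n B (left_span n (set (rows A)))" and card: "k < card B"
    by (metis not_le)
  have "\<exists>g. \<forall>j<n. b $ j = (\<Sum>l<k. g l * v l j)" if "b \<in> B" for b
  proof -
    have "b \<in> left_span n B"
      using B that by (intro left_span_superset) (auto simp: left_basis_def)
    then have "b \<in> left_span n (set (rows A))" using B by (simp add: left_basis_def)
    then obtain c where c: "b = left_lincomb n c (set (rows A))"
      using left_span_finite[of "set (rows A)"] by auto
    have "\<exists>h. \<forall>j<n. x $ j = (\<Sum>l<k. h l * v l j)" if "x \<in> set (rows A)" for x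
    proof -
      from that A obtain i where "i < m" "x = row A i" by (auto simp: rows_def)
      with A sum show ?thesis by (intro exI[of _ "\<lambda>l. u l i"]) auto
    qed
    then obtain h where h: "\<And>x j. x \<in> set (rows A) \<Longrightarrow> j < n \<Longrightarrow> x $ j = (\<Sum>l<k. h x l * v l j)"
      by metis
    have "b $ j = (\<Sum>l<k. (\<Sum>x\<in>set (rows A). c x * h x l) * v l j)" if j: "j < n" for j
    proof -
      have "b $ j = (\<Sum>x\<in>set (rows A). c x * (\<Sum>l<k. h x l * v l j))"
        using h j by (auto simp: c left_lincomb_index intro!: sum.cong)
      also have "\<dots> = (\<Sum>l<k. (\<Sum>x\<in>set (rows A). c x * h x l) * v l j)"
        by (simp add: sum_distrib_left sum_distrib_right mult.assoc)
           (rule sum.swap)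
      finally show ?thesis .
    qed
    then show ?thesis by (intro exI[of _ "\<lambda>l. \<Sum>x\<in>set (rows A). c x * h x l"]) blast
  qed
  then obtain g where g: "\<And>b j. b \<in> B \<Longrightarrow> j < n \<Longrightarrow> b $ j = (\<Sum>l<k. g b l * v l j)"
    by metis
  have "finite B" using B by (simp add: left_basis_def)
  then obtain c where c: "\<exists>b\<in>B. c b \<noteq> 0" "\<forall>l<k. (\<Sum>b\<in>B. c b * g b l) = 0"
    using nontrivial_left_relation[of B k g] card by auto
  have "(\<Sum>b\<in>B. c b * b $ j) = 0" if "j < n" for j
  proof -
    have "(\<Sum>b\<in>B. c b * b $ j) = (\<Sum>b\<in>B. c b * (\<Sum>l<k. g b l * v l j))"
      using g that by auto
    also have "\<dots> = (\<Sum>l<k. (\<Sum>b\<in>B. c b * g b l) * v l j)"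
      by (simp add: sum_distrib_left sum_distrib_right mult.assoc) (rule sum.swap)
    finally show ?thesis using c(2) by simp
  qed
  then have "left_lincomb n c B = 0\<^sub>v n"
    by (intro eq_vecI) (auto simp: left_lincomb_def)
  with B c(1) show False by (auto simp: left_basis_def)
qed

lemma mat_rank_eq_0_iff:
  fixes A :: "'a::division_ring mat"
  assumes A: "A \<in> carrier_mat m n"
  shows "mat_rank A = 0 \<longleftrightarrow> A = 0\<^sub>m m n"
proof
  assume "mat_rank A = 0"
  with mat_rank_basis[OF A] obtain B
    where "left_basis n B (left_span n (set (rows A)))" and "card B = 0"
    by metis
  then have span: "left_span n (set (rows A)) = left_span n {}"
    by (auto simp: left_basis_def)
  have "A $$ (i, j) = 0" if "i < m" "j < n" for i j
  proof -
    have "row A i \<in> left_span n {}"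
      unfolding span[symmetric] using A that by (intro left_span_superset) (auto simp: rows_def)
    then have "row A i = 0\<^sub>v n"
      using left_span_finite[of "{}" n] by (auto simp: left_lincomb_def zero_vec_def)
    then have "row A i $ j = 0" using that by simp
    then show ?thesis using A that by simp
  qed
  then show "A = 0\<^sub>m m n" using A by (intro eq_matI) auto
next
  assume "A = 0\<^sub>m m n"
  then have "mat_rank A \<le> 0" by (intro mat_rank_le[OF A]) auto
  then show "mat_rank A = 0" by simp
qed

lemma mat_rank_le_1_iff:
  fixes A :: "'a::division_ring mat"
  assumes A: "A \<in> carrier_mat m n"
  shows "mat_rank A \<le> 1 \<longleftrightarrow> (\<exists>u v. \<forall>i<m. \<forall>j<n. A $$ (i, j) = u i * v j)"
proof
  assume le: "mat_rank A \<le> 1"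
  from mat_rank_basis[OF A] le obtain B
    where B: "left_basis n B (left_span n (set (rows A)))" and card: "card B \<le> 1"
    by metis
  have "finite B" using B by (simp add: left_basis_def)
  \<comment> \<open>The inclusion also covers the empty basis, that is, rank 0.\<close>
  with card have sub: "\<exists>b. B \<subseteq> {b}"
    by (metis card_le_Suc0_iff_eq One_nat_def empty_subsetI singletonI subsetI subset_singletonD)
  then obtain b where b: "B \<subseteq> {b}" by blast
  have "\<exists>c. \<forall>j<n. A $$ (i, j) = c * b $ j" if i: "i < m" for i
  proof -
    have "row A i \<in> left_span n (set (rows A))"
      using A i by (intro left_span_superset) (auto simp: rows_def)
    then have "row A i \<in> left_span n {b}"
      using B left_span_mono[OF b, of n] by (auto simp: left_basis_def)
    then obtain c where "row A i = left_lincomb n c {b}"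
      using left_span_finite[of "{b}" n] by auto
    then have "A $$ (i, j) = c b * b $ j" if "j < n" for j
      using A i that left_lincomb_index[OF that, of c "{b}"] by (metis carrier_matD index_row(1)
          sum.insert sum.empty finite.emptyI empty_iff add.right_neutral)
    then show ?thesis by blast
  qed
  then obtain c where "\<forall>i<m. \<forall>j<n. A $$ (i, j) = c i * b $ j" by metis
  then show "\<exists>u v. \<forall>i<m. \<forall>j<n. A $$ (i, j) = u i * v j"
    by (intro exI[of _ c] exI[of _ "\<lambda>j. b $ j"])
next
  assume "\<exists>u v. \<forall>i<m. \<forall>j<n. A $$ (i, j) = u i * v j"
  then obtain u v where "\<forall>i<m. \<forall>j<n. A $$ (i, j) = u i * v j" by blast
  then show "mat_rank A \<le> 1"
    by (intro mat_rank_le[OF A, where k = 1 and u = "\<lambda>_. u" and v = "\<lambda>_. v"]) auto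
qed

section \<open>Adjacency geometries\<close>

text \<open>Points stand for matrices, \<open>near\<close> for rank distance at most one,
  \<open>Ms\<close> and \<open>Ns\<close> for the maximal sets of the two types. The axioms are
  symmetric in the two families, so that statements can be mirrored.\<close>

locale adjacency_geometry =
  fixes near :: "'p \<Rightarrow> 'p \<Rightarrow> bool" and Ms Ns :: "'p set set"
  assumes near_sym: "near x y \<Longrightarrow> near y x"
    and clique: "L \<in> Ms \<union> Ns \<Longrightarrow> x \<in> L \<Longrightarrow> y \<in> L \<Longrightarrow> near x y"
    and span: "near p q \<Longrightarrow> p \<noteq> q \<Longrightarrow>
      \<exists>M\<in>Ms. \<exists>N\<in>Ns. p \<in> M \<inter> N \<and> q \<in> M \<inter> N \<and> (\<forall>x. near x p \<longrightarrow> near x q \<longrightarrow> x \<in> M \<union> N)"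
    and M_eq: "M \<in> Ms \<Longrightarrow> M' \<in> Ms \<Longrightarrow> p \<in> M \<inter> M' \<Longrightarrow> q \<in> M \<inter> M' \<Longrightarrow> p \<noteq> q \<Longrightarrow> M = M'"
    and N_eq: "N \<in> Ns \<Longrightarrow> N' \<in> Ns \<Longrightarrow> p \<in> N \<inter> N' \<Longrightarrow> q \<in> N \<inter> N' \<Longrightarrow> p \<noteq> q \<Longrightarrow> N = N'"
    and cross: "M \<in> Ms \<Longrightarrow> N \<in> Ns \<Longrightarrow> M \<inter> N \<noteq> {} \<Longrightarrow> x \<in> M - N \<Longrightarrow> y \<in> N - M \<Longrightarrow> \<not> near x y"
begin

lemma opposite: "adjacency_geometry near Ns Ms"
proof unfold_locales
  show "\<exists>M\<in>Ns. \<exists>N\<in>Ms. p \<in> M \<inter> N \<and> q \<in> M \<inter> N \<and> (\<forall>x. near x p \<longrightarrow> near x q \<longrightarrow> x \<in> M \<union> N)"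
    if "near p q" "p \<noteq> q" for p q
    using span[OF that] by blast
  show "\<not> near x y" if "M \<in> Ns" "N \<in> Ms" "M \<inter> N \<noteq> {}" "x \<in> M - N" "y \<in> N - M" for M N x y
    using cross[of N M y x] near_sym that by blast
  show "near x y" if "L \<in> Ns \<union> Ms" "x \<in> L" "y \<in> L" for L x y
    using clique[of L x y] that by blast
qed (fact near_sym M_eq N_eq)+

text \<open>By \<open>M_eq\<close> and \<open>N_eq\<close> the pair that \<open>span\<close>
  provides for \<open>p\<close> and \<open>q\<close> can only be \<open>M\<close> and
  \<open>N\<close>.\<close>

lemma common_nbrs:
  assumes "M \<in> Ms" "N \<in> Ns" "p \<in> M \<inter> N" "q \<in> M \<inter> N" "p \<noteq> q" "near x p" "near x q"
  shows "x \<in> M \<union> N"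
proof -
  have "near p q" using assms clique[of M] by blast
  from span[OF this assms(5)] obtain M' N' where "M' \<in> Ms" "N' \<in> Ns" "p \<in> M' \<inter> N'" "q \<in> M' \<inter> N'"
    and nbrs: "\<forall>x. near x p \<longrightarrow> near x q \<longrightarrow> x \<in> M' \<union> N'" by blast
  then have "M' = M" "N' = N" using M_eq[of M' M p q] N_eq[of N' N p q] assms by auto
  with nbrs assms show ?thesis by simp
qed

lemma clique_in_union:
  assumes "M \<in> Ms" "N \<in> Ns" "M \<inter> N \<noteq> {}" "C \<subseteq> M \<union> N" "\<forall>x\<in>C. \<forall>y\<in>C. near x y"
  shows "C \<subseteq> M \<or> C \<subseteq> N"
  using cross[of M N] assms by blast

end

text \<open>
  The \<open>grid\<close> axiom is where the division ring needs at least four elements: two points at distance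
  two have enough common neighbours.
\<close>
locale adjacency_hom =
  S: adjacency_geometry near Ms Ns + T: adjacency_geometry near' Ms' Ns'
  for near :: "'p \<Rightarrow> 'p \<Rightarrow> bool" and Ms Ns and near' :: "'q \<Rightarrow> 'q \<Rightarrow> bool" and Ms' Ns' +
  fixes \<phi> :: "'p \<Rightarrow> 'q"
  assumes hom: "near x y \<Longrightarrow> near' (\<phi> x) (\<phi> y)"
    and inj: "near x y \<Longrightarrow> x \<noteq> y \<Longrightarrow> \<phi> x \<noteq> \<phi> y"
    and meet: "L \<in> Ms \<Longrightarrow> R \<in> Ns \<Longrightarrow> A \<in> L \<inter> R \<Longrightarrow> \<exists>B\<in>L \<inter> R. B \<noteq> A"
    and grid: "L0 \<in> Ms \<Longrightarrow> R0 \<in> Ns \<Longrightarrow> A \<in> L0 \<inter> R0 \<Longrightarrow> B \<in> L0 \<inter> R0 \<Longrightarrow> A \<noteq> B \<Longrightarrow>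
      near B X \<Longrightarrow> \<not> near A X \<Longrightarrow>
      \<exists>L\<in>Ms. \<exists>L'\<in>Ms. \<exists>R\<in>Ns. \<exists>P\<in>L0 \<inter> R. \<exists>Q\<in>L \<inter> R0. \<exists>Q'\<in>L' \<inter> R0. \<exists>T\<in>L \<inter> R. \<exists>T'\<in>L' \<inter> R.
        A \<in> L \<inter> L' \<inter> R \<and> P \<noteq> B \<and> Q \<noteq> B \<and> Q' \<noteq> B \<and> T \<noteq> T' \<and>
        near P X \<and> near Q X \<and> near Q' X \<and> near T X \<and> near T' X"
begin

text \<open>\<open>grid\<close> is not symmetric in the source families, so only the two types in
  the target are exchanged. This is enough to mirror every statement about \<open>M\<close> and
  \<open>N\<close>.\<close>

lemma target_opposite: "adjacency_hom near Ms Ns near' Ns' Ms' \<phi>"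
proof -
  interpret T': adjacency_geometry near' Ns' Ms' by (rule T.opposite)
  show ?thesis by unfold_locales (fact hom inj meet grid)+
qed

section \<open>Collapsing points\<close>

definition collapses :: "'p \<Rightarrow> 'q set \<Rightarrow> 'q set \<Rightarrow> bool" where
  "collapses A M N \<longleftrightarrow> M \<in> Ms' \<and> N \<in> Ns' \<and> \<phi> A \<in> M \<inter> N \<and> \<phi> ` {X. near A X} \<subseteq> M \<union> N"

lemma image_line:
  assumes "collapses A M N" "L \<in> Ms \<union> Ns" "A \<in> L"
  shows "\<phi> ` L \<subseteq> M \<or> \<phi> ` L \<subseteq> N"
proof (rule T.clique_in_union)
  show "\<phi> ` L \<subseteq> M \<union> N"
    using assms S.clique[of L A] by (auto simp: collapses_def)
  show "\<forall>x\<in>\<phi> ` L. \<forall>y\<in>\<phi> ` L. near' x y"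
    using assms(2) S.clique hom by blast
qed (use assms in \<open>auto simp: collapses_def\<close>)

lemma collapses_if_both_lines_in:
  assumes L0: "L0 \<in> Ms" "B \<in> L0" "\<phi> ` L0 \<subseteq> M" and R0: "R0 \<in> Ns" "B \<in> R0" "\<phi> ` R0 \<subseteq> M"
    and M: "M \<in> Ms'"
  shows "\<exists>N. collapses B M N"
proof -
  \<comment> \<open>The image of \<open>L\<close> consists of common neighbours of \<phi> B and
    \<phi> C, which both lie in \<open>M\<close>. At this stage \<open>N\<close> may still depend on
    \<open>L\<close>.\<close>
  have pencil: "\<exists>N\<in>Ns'. \<phi> B \<in> N \<and> \<phi> C \<in> N \<and> \<phi> ` L \<subseteq> M \<union> N"
    if L: "L \<in> Ms \<union> Ns" "B \<in> L" "C \<in> L" "C \<noteq> B" "\<phi> C \<in> M" for L C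
  proof -
    have "near B C" using S.clique L by blast
    then have near': "near' (\<phi> B) (\<phi> C)" "\<phi> B \<noteq> \<phi> C" using hom inj L(4) by blast+
    from T.span[OF this] obtain M1 N where N: "M1 \<in> Ms'" "N \<in> Ns'"
      "\<phi> B \<in> M1 \<inter> N" "\<phi> C \<in> M1 \<inter> N" "\<forall>x. near' x (\<phi> B) \<longrightarrow> near' x (\<phi> C) \<longrightarrow> x \<in> M1 \<union> N"
      by blast
    have "M1 = M"
      using T.M_eq[of M1 M "\<phi> B" "\<phi> C"] N M near' L(5) L0 by blast
    moreover have "near' (\<phi> x) (\<phi> B) \<and> near' (\<phi> x) (\<phi> C)" if "x \<in> L" for x
      using that L S.clique hom by blast
    ultimately show ?thesis using N by blast
  qed
  have dich: "\<phi> ` L \<subseteq> M \<or> \<phi> ` L \<subseteq> N"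
    if "L \<in> Ms \<union> Ns" "B \<in> L" "N \<in> Ns'" "\<phi> B \<in> N" "\<phi> ` L \<subseteq> M \<union> N" for L N
    using that M L0 S.clique hom by (intro T.clique_in_union) blast+
  obtain C where C: "C \<in> L0" "C \<in> R0" "C \<noteq> B" using meet[of L0 R0 B] L0 R0 by blast
  show ?thesis
  \<comment> \<open>If all sets of \<open>Ms\<close> through \<open>B\<close> go to
    \<open>M\<close>, they already cover the ball, and any \<open>N\<close> through \<phi> B will
    do. Otherwise an exceptional \<open>L1\<close> fixes \<open>N\<close>.\<close>
  proof (cases "\<forall>L\<in>Ms. B \<in> L \<longrightarrow> \<phi> ` L \<subseteq> M")
    case True
    obtain N where N: "N \<in> Ns'" "\<phi> B \<in> N" using pencil[of L0 C] L0 C by blast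
    have "\<phi> X \<in> M" if "near B X" for X
    proof (cases "X = B")
      case False
      with S.span[OF that] True show ?thesis by blast
    qed (use L0 in blast)
    then show ?thesis using N M L0 unfolding collapses_def by (intro exI[of _ N]) blast
  next
    case False
    then obtain L1 where L1: "L1 \<in> Ms" "B \<in> L1" "\<not> \<phi> ` L1 \<subseteq> M" by blast
    obtain C1 where C1: "C1 \<in> L1" "C1 \<in> R0" "C1 \<noteq> B" using meet[of L1 R0 B] L1 R0 by blast
    obtain N where N: "N \<in> Ns'" "\<phi> B \<in> N" "\<phi> ` L1 \<subseteq> M \<union> N" using pencil[of L1 C1] L1 C1 R0 by blast
    have L1N: "\<phi> ` L1 \<subseteq> N" using dich[of L1 N] L1 N by blast
    have R: "\<phi> ` R \<subseteq> M \<union> N" if R: "R \<in> Ns" "B \<in> R" for R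
    proof (rule ccontr)
      assume not: "\<not> \<phi> ` R \<subseteq> M \<union> N"
      obtain C2 where C2: "C2 \<in> L0" "C2 \<in> R" "C2 \<noteq> B" using meet[of L0 R B] L0 R by blast
      obtain N2 where N2: "N2 \<in> Ns'" "\<phi> B \<in> N2" "\<phi> ` R \<subseteq> M \<union> N2"
        using pencil[of R C2] R C2 L0 by blast
      have RN2: "\<phi> ` R \<subseteq> N2" using dich[of R N2] R N2 not by blast
      \<comment> \<open>The image of \<open>C3\<close> lies in both \<open>N\<close> and
        \<open>N2\<close>, and together with \<phi> B it determines such a set.\<close>
      obtain C3 where C3: "C3 \<in> L1" "C3 \<in> R" "C3 \<noteq> B" using meet[of L1 R B] L1 R by blast
      have "\<phi> C3 \<noteq> \<phi> B" using C3 L1 S.clique inj by (metis UnI1)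
      moreover have "\<phi> C3 \<in> N2" "\<phi> C3 \<in> N" using C3 L1N RN2 by blast+
      ultimately have "N2 = N" using T.N_eq[of N2 N "\<phi> B" "\<phi> C3"] N N2 by simp
      with not RN2 show False by blast
    qed
    have "\<phi> X \<in> M \<union> N" if "near B X" for X
    proof (cases "X = B")
      case False
      with S.span[OF that] R show ?thesis by blast
    qed (use L0 in blast)
    then show ?thesis using N M L0 unfolding collapses_def by (intro exI[of _ N]) blast
  qed
qed

text \<open>
  Otherwise the grid produces two distinct adjacent points whose images lie in \<open>M \<inter> N\<close> and are
  adjacent to \<open>\<phi> X\<close>; by \<open>common_nbrs\<close> this forces \<open>\<phi> X\<close> to be adjacent to \<open>\<phi> A\<close>.
\<close>
lemma not_in_different_sets:
  assumes deg: "collapses A M N"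
    and L0: "L0 \<in> Ms" "A \<in> L0" "B \<in> L0" and R0: "R0 \<in> Ns" "A \<in> R0" "B \<in> R0"
    and "A \<noteq> B" "near B X" and far: "\<not> near' (\<phi> A) (\<phi> X)"
    and M: "\<phi> ` L0 \<subseteq> M" and N: "\<phi> ` R0 \<subseteq> N"
  shows False
proof -
  have MN: "M \<in> Ms'" "N \<in> Ns'" "\<phi> A \<in> M \<inter> N" using deg by (auto simp: collapses_def)
  have unique: "Y = Z"
    if "near Y X" "near Z X" "near Y Z" "\<phi> Y \<in> M \<inter> N" "\<phi> Z \<in> M \<inter> N" for Y Z
  proof (rule ccontr)
    assume "Y \<noteq> Z"
    then have "\<phi> Y \<noteq> \<phi> Z" using that inj by blast
    then have "\<phi> X \<in> M \<union> N"
      using T.common_nbrs[of M N "\<phi> Y" "\<phi> Z" "\<phi> X"] MN that hom S.near_sym by blast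
    then show False using far MN T.clique by blast
  qed
  have "\<not> near A X" using far hom by blast
  from grid[OF L0(1) R0(1) _ _ \<open>A \<noteq> B\<close> \<open>near B X\<close> this] L0 R0
  obtain L L' R P Q Q' T T' where g: "L \<in> Ms" "L' \<in> Ms" "R \<in> Ns"
    "P \<in> L0" "P \<in> R" "Q \<in> L" "Q \<in> R0" "Q' \<in> L'" "Q' \<in> R0" "T \<in> L" "T \<in> R" "T' \<in> L'" "T' \<in> R"
    "A \<in> L" "A \<in> L'" "A \<in> R" "P \<noteq> B" "Q \<noteq> B" "Q' \<noteq> B" "T \<noteq> T'"
    "near P X" "near Q X" "near Q' X" "near T X" "near T' X"
    by blast
  have B: "\<phi> B \<in> M \<inter> N" using L0 R0 M N by blast
  \<comment> \<open>\<open>P\<close> and \<open>B\<close> both lie on \<open>L0\<close> and are near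
    \<open>X\<close>, so \<phi> P in \<open>N\<close> would give \<open>P = B\<close> by
    \<open>unique\<close>. As \<open>R\<close> contains \<open>P\<close>, it must go to
    \<open>M\<close>; by the same reasoning \<open>Q\<close> and \<open>Q'\<close> send
    \<open>L\<close> and \<open>L'\<close> to \<open>N\<close>.\<close>
  have "\<phi> P \<notin> N"
    using unique[of P B] g(4,17,21) B M S.clique[of L0 P B] L0 \<open>near B X\<close> by blast
  then have R: "\<phi> ` R \<subseteq> M" using image_line[OF deg, of R] g by blast
  have "\<phi> Q \<notin> M"
    using unique[of Q B] g(7,18,22) B N S.clique[of R0 Q B] R0 \<open>near B X\<close> by blast
  then have L: "\<phi> ` L \<subseteq> N" using image_line[OF deg, of L] g by blast
  have "\<phi> Q' \<notin> M"
    using unique[of Q' B] g(9,19,23) B N S.clique[of R0 Q' B] R0 \<open>near B X\<close> by blast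
  then have L': "\<phi> ` L' \<subseteq> N" using image_line[OF deg, of L'] g by blast
  \<comment> \<open>\<open>T\<close> and \<open>T'\<close> lie on \<open>R\<close> and on one of
    \<open>L\<close>, \<open>L'\<close>, so their images are in both \<open>M\<close> and
    \<open>N\<close>.\<close>
  have "T = T'"
    using unique[of T T'] g R L L' S.clique[of R T T'] by blast
  with g show False by blast
qed

text \<open>The images of \<open>A\<close> and \<open>B\<close> are distinct points of both
  \<open>M\<close> and \<open>N\<close>. By \<open>not_in_different_sets\<close> every point near
  \<open>B\<close> is sent to a common neighbour of these two images.\<close>

lemma collapses_if_lines_split:
  assumes deg: "collapses A M N"
    and L0: "L0 \<in> Ms" "A \<in> L0" "B \<in> L0" and R0: "R0 \<in> Ns" "A \<in> R0" "B \<in> R0"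
    and "A \<noteq> B" and M: "\<phi> ` L0 \<subseteq> M" and N: "\<phi> ` R0 \<subseteq> N"
  shows "collapses B M N"
proof -
  have MN: "M \<in> Ms'" "N \<in> Ns'" "\<phi> A \<in> M \<inter> N" using deg by (auto simp: collapses_def)
  have B: "\<phi> B \<in> M \<inter> N" using L0 R0 M N by blast
  have "\<phi> A \<noteq> \<phi> B" using inj[of A B] S.clique[of L0 A B] L0 \<open>A \<noteq> B\<close> by blast
  have "\<phi> X \<in> M \<union> N" if X: "near B X" for X
  proof -
    have "near' (\<phi> A) (\<phi> X)"
      using not_in_different_sets[OF deg L0 R0 \<open>A \<noteq> B\<close> X _ M N] by blast
    then show ?thesis
      using T.common_nbrs[OF MN(1,2,3) B \<open>\<phi> A \<noteq> \<phi> B\<close>] hom[OF X] T.near_sym by blast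
  qed
  with MN B show ?thesis by (auto simp: collapses_def)
qed

lemma opposite_collapses:
  "adjacency_hom.collapses near Ns' Ms' \<phi> A N M \<longleftrightarrow> collapses A M N"
proof -
  interpret opp: adjacency_hom near Ms Ns near' Ns' Ms' \<phi> by (rule target_opposite)
  show ?thesis unfolding collapses_def opp.collapses_def by blast
qed

text \<open>Four cases, according to which of \<open>M\<close>, \<open>N\<close> receives the two
  lines through \<open>A\<close> and \<open>B\<close>. The cases with \<open>L0\<close> going to
  \<open>N\<close> follow by exchanging the types in the target.\<close>

lemma collapses_near:
  assumes deg: "\<exists>M N. collapses A M N" and "near A B"
  shows "\<exists>M N. collapses B M N"
proof (cases "A = B")
  case False
  obtain M N where MN: "collapses A M N" using deg by blast
  interpret opp: adjacency_hom near Ms Ns near' Ns' Ms' \<phi> by (rule target_opposite)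
  have opp: "opp.collapses X N M \<longleftrightarrow> collapses X M N" for X M N
    by (rule opposite_collapses)
  obtain L0 R0 where LR: "L0 \<in> Ms" "A \<in> L0" "B \<in> L0" "R0 \<in> Ns" "A \<in> R0" "B \<in> R0"
    using S.span[OF \<open>near A B\<close> False] by blast
  have "M \<in> Ms'" "N \<in> Ns'" using MN by (auto simp: collapses_def)
  have L: "\<phi> ` L0 \<subseteq> M \<or> \<phi> ` L0 \<subseteq> N" and R: "\<phi> ` R0 \<subseteq> M \<or> \<phi> ` R0 \<subseteq> N"
    using image_line[OF MN] LR by blast+
  from L show ?thesis
  proof
    assume L: "\<phi> ` L0 \<subseteq> M"
    from R show ?thesis
    proof
      assume "\<phi> ` R0 \<subseteq> M"
      from collapses_if_both_lines_in[OF LR(1,3) L LR(4,6) this \<open>M \<in> Ms'\<close>] show ?thesis by blast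
    next
      assume "\<phi> ` R0 \<subseteq> N"
      from collapses_if_lines_split[OF MN LR False L this] show ?thesis by blast
    qed
  next
    assume L: "\<phi> ` L0 \<subseteq> N"
    from R show ?thesis
    proof
      assume "\<phi> ` R0 \<subseteq> M"
      from opp.collapses_if_lines_split[OF _ LR False L this] MN show ?thesis
        unfolding opp by blast
    next
      assume "\<phi> ` R0 \<subseteq> N"
      from opp.collapses_if_both_lines_in[OF LR(1,3) L LR(4,6) this \<open>N \<in> Ns'\<close>] show ?thesis
        unfolding opp by blast
    qed
  qed
qed (use deg in simp)

text \<open>
  If \<open>L\<close> went to \<open>M\<close> and \<open>L'\<close> to \<open>N\<close>, then by \<open>not_in_different_sets\<close> the line \<open>R\<close> could go to
  neither, so all lines of one type through a linked collapsing point go to the same set.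
\<close>
definition row_linked :: "'p \<Rightarrow> bool" where
  "row_linked A \<longleftrightarrow> (\<forall>L\<in>Ms. \<forall>L'\<in>Ms. A \<in> L \<longrightarrow> A \<in> L' \<longrightarrow> L \<noteq> L' \<longrightarrow>
     (\<exists>X. \<exists>R\<in>Ns. \<exists>B\<in>L \<inter> R. \<exists>B'\<in>L' \<inter> R. A \<in> R \<and> B \<noteq> A \<and> B' \<noteq> A \<and> near B X \<and> near B' X \<and>
       \<not> near' (\<phi> A) (\<phi> X)))"

definition col_linked :: "'p \<Rightarrow> bool" where
  "col_linked A \<longleftrightarrow> (\<forall>R\<in>Ns. \<forall>R'\<in>Ns. A \<in> R \<longrightarrow> A \<in> R' \<longrightarrow> R \<noteq> R' \<longrightarrow>
     (\<exists>X. \<exists>L\<in>Ms. \<exists>B\<in>R \<inter> L. \<exists>B'\<in>R' \<inter> L. A \<in> L \<and> B \<noteq> A \<and> B' \<noteq> A \<and> near B X \<and> near B' X \<and>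
       \<not> near' (\<phi> A) (\<phi> X)))"

text \<open>The mirror image of \<open>not_in_different_sets\<close> under exchange of the target
  types.\<close>

lemma not_in_different_sets':
  assumes "collapses A M N"
    and "L0 \<in> Ms" "A \<in> L0" "B \<in> L0" "R0 \<in> Ns" "A \<in> R0" "B \<in> R0"
    and "A \<noteq> B" "near B X" "\<not> near' (\<phi> A) (\<phi> X)"
    and "\<phi> ` L0 \<subseteq> N" "\<phi> ` R0 \<subseteq> M"
  shows False
proof -
  interpret opp: adjacency_hom near Ms Ns near' Ns' Ms' \<phi> by (rule target_opposite)
  show ?thesis
    by (rule opp.not_in_different_sets[of A N M L0 B R0 X]) (use opposite_collapses assms in auto)
qed

lemma ball_image_in_one_set:
  assumes deg: "collapses A M N" and linked: "row_linked A \<or> col_linked A"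
  shows "\<phi> ` {X. near A X} \<subseteq> M \<or> \<phi> ` {X. near A X} \<subseteq> N"
proof -
  have A: "\<phi> A \<in> M" "\<phi> A \<in> N" using deg by (auto simp: collapses_def)
  \<comment> \<open>By \<open>span\<close> each point near \<open>A\<close> lies on lines of both
    families through \<open>A\<close>, so controlling one family controls the whole ball.\<close>
  have ball: "\<phi> ` {X. near A X} \<subseteq> K"
    if K: "\<phi> A \<in> K" "(\<forall>L\<in>Ms. A \<in> L \<longrightarrow> \<phi> ` L \<subseteq> K) \<or> (\<forall>R\<in>Ns. A \<in> R \<longrightarrow> \<phi> ` R \<subseteq> K)" for K
  proof -
    have "\<phi> X \<in> K" if "near A X" for X
    proof (cases "X = A")
      case False
      then show ?thesis using S.span[OF that] K(2) by blast
    qed (use K in blast)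
    then show ?thesis by blast
  qed
  from linked show ?thesis
  proof
    assume linked: "row_linked A"
    have False if "L \<in> Ms" "L' \<in> Ms" "A \<in> L" "A \<in> L'" "\<not> \<phi> ` L \<subseteq> N" "\<not> \<phi> ` L' \<subseteq> M" for L L'
    proof -
      have L: "\<phi> ` L \<subseteq> M" "\<phi> ` L' \<subseteq> N"
        using image_line[OF deg, of L] image_line[OF deg, of L'] that by simp_all
      with that have "L \<noteq> L'" by auto
      with linked[unfolded row_linked_def, rule_format, of L L'] that
      obtain X R B B' where R: "R \<in> Ns" "A \<in> R" "B \<in> L" "B \<in> R" "B' \<in> L'" "B' \<in> R"
        "B \<noteq> A" "B' \<noteq> A" "near B X" "near B' X" "\<not> near' (\<phi> A) (\<phi> X)"
        by auto
      have "\<not> \<phi> ` R \<subseteq> N"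
        by (rule notI, rule not_in_different_sets[OF deg, of L B R X]) (use R L that in auto)
      moreover have "\<not> \<phi> ` R \<subseteq> M"
        by (rule notI, rule not_in_different_sets'[OF deg, of L' B' R X]) (use R L that in auto)
      ultimately show False using image_line[OF deg, of R] R by simp
    qed
    then have "(\<forall>L\<in>Ms. A \<in> L \<longrightarrow> \<phi> ` L \<subseteq> M) \<or> (\<forall>L\<in>Ms. A \<in> L \<longrightarrow> \<phi> ` L \<subseteq> N)" by metis
    then show ?thesis using ball[of M] ball[of N] A by metis
  next
    assume linked: "col_linked A"
    have False if "R \<in> Ns" "R' \<in> Ns" "A \<in> R" "A \<in> R'" "\<not> \<phi> ` R \<subseteq> N" "\<not> \<phi> ` R' \<subseteq> M" for R R'
    proof -
      have R: "\<phi> ` R \<subseteq> M" "\<phi> ` R' \<subseteq> N"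
        using image_line[OF deg, of R] image_line[OF deg, of R'] that by simp_all
      with that have "R \<noteq> R'" by auto
      with linked[unfolded col_linked_def, rule_format, of R R'] that
      obtain X L B B' where L: "L \<in> Ms" "A \<in> L" "B \<in> R" "B \<in> L" "B' \<in> R'" "B' \<in> L"
        "B \<noteq> A" "B' \<noteq> A" "near B X" "near B' X" "\<not> near' (\<phi> A) (\<phi> X)"
        by auto
      have "\<not> \<phi> ` L \<subseteq> N"
        by (rule notI, rule not_in_different_sets'[OF deg, of L B R X]) (use R L that in auto)
      moreover have "\<not> \<phi> ` L \<subseteq> M"
        by (rule notI, rule not_in_different_sets[OF deg, of L B' R' X]) (use R L that in auto)
      ultimately show False using image_line[OF deg, of L] L by simp
    qed
    then have "(\<forall>R\<in>Ns. A \<in> R \<longrightarrow> \<phi> ` R \<subseteq> M) \<or> (\<forall>R\<in>Ns. A \<in> R \<longrightarrow> \<phi> ` R \<subseteq> N)" by metis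
    then show ?thesis using ball[of M] ball[of N] A by metis
  qed
qed

end

section \<open>The geometry of matrices\<close>

text \<open>Rank distance at most one, with the difference written as an outer product so that
  entries can be computed directly. Equality is allowed, and the dimensions are part of the
  relation.\<close>

definition mat_near :: "nat \<Rightarrow> nat \<Rightarrow> 'a::division_ring mat \<Rightarrow> 'a mat \<Rightarrow> bool" where
  "mat_near m n A B \<longleftrightarrow> A \<in> carrier_mat m n \<and> B \<in> carrier_mat m n \<and>
     (\<exists>u v. \<forall>i<m. \<forall>j<n. B $$ (i, j) = A $$ (i, j) + u i * v j)"

text \<open>A set of type one has this form, with \<open>u\<close> the first column of
  \<open>P\<close>. The column \<open>u\<close> is fixed and the row \<open>y\<close> is free; in
  \<open>col_line\<close> it is the other way round.\<close>

definition row_line :: "nat \<Rightarrow> nat \<Rightarrow> (nat \<Rightarrow> 'a) \<Rightarrow> 'a::division_ring mat \<Rightarrow> 'a mat set" where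
  "row_line m n u A =
     {X \<in> carrier_mat m n. \<exists>y. \<forall>i<m. \<forall>j<n. X $$ (i, j) = A $$ (i, j) + u i * y j}"

definition col_line :: "nat \<Rightarrow> nat \<Rightarrow> (nat \<Rightarrow> 'a) \<Rightarrow> 'a::division_ring mat \<Rightarrow> 'a mat set" where
  "col_line m n v A =
     {X \<in> carrier_mat m n. \<exists>x. \<forall>i<m. \<forall>j<n. X $$ (i, j) = A $$ (i, j) + x i * v j}"

definition row_lines :: "nat \<Rightarrow> nat \<Rightarrow> 'a::division_ring mat set set" where
  "row_lines m n = {row_line m n u A | u A. A \<in> carrier_mat m n \<and> (\<exists>i<m. u i \<noteq> 0)}"

definition col_lines :: "nat \<Rightarrow> nat \<Rightarrow> 'a::division_ring mat set set" where
  "col_lines m n = {col_line m n v A | v A. A \<in> carrier_mat m n \<and> (\<exists>j<n. v j \<noteq> 0)}"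

section \<open>Nearness and rank\<close>

lemma mat_nearI:
  assumes "A \<in> carrier_mat m n" "B \<in> carrier_mat m n"
    and "\<And>i j. i < m \<Longrightarrow> j < n \<Longrightarrow> B $$ (i, j) = A $$ (i, j) + u i * v j"
  shows "mat_near m n A B"
  using assms unfolding mat_near_def by blast

lemma mat_near_refl: "A \<in> carrier_mat m n \<Longrightarrow> mat_near m n A A"
  by (rule mat_nearI[where u = "\<lambda>_. 0"]) auto

lemma mat_near_sym:
  assumes "mat_near m n A B"
  shows "mat_near m n B A"
proof -
  from assms obtain u v where "A \<in> carrier_mat m n" "B \<in> carrier_mat m n"
    "\<forall>i<m. \<forall>j<n. B $$ (i, j) = A $$ (i, j) + u i * v j"
    unfolding mat_near_def by blast
  then show ?thesis by (intro mat_nearI[where u = u and v = "\<lambda>j. - v j"]) auto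
qed

lemma mat_near_iff_rank:
  assumes A: "A \<in> carrier_mat m n" and B: "B \<in> carrier_mat m n"
  shows "mat_near m n A B \<longleftrightarrow> mat_rank (B - A) \<le> 1"
proof -
  have "mat_rank (B - A) \<le> 1 \<longleftrightarrow> (\<exists>u v. \<forall>i<m. \<forall>j<n. (B - A) $$ (i, j) = u i * v j)"
    using A B by (intro mat_rank_le_1_iff) auto
  also have "\<dots> \<longleftrightarrow> (\<exists>u v. \<forall>i<m. \<forall>j<n. B $$ (i, j) = A $$ (i, j) + u i * v j)"
    using A B by (simp add: diff_eq_eq add.commute)
  finally show ?thesis using A B by (simp add: mat_near_def)
qed

lemma minus_mat_eq_0_iff:
  fixes A :: "'a::division_ring mat"
  assumes "A \<in> carrier_mat m n" "B \<in> carrier_mat m n"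
  shows "A - B = 0\<^sub>m m n \<longleftrightarrow> A = B"
  using assms by (auto simp: mat_eq_iff)

lemma adjacent_iff:
  assumes "A \<in> carrier_mat m n" "B \<in> carrier_mat m n"
  shows "adjacent A B \<longleftrightarrow> mat_near m n A B \<and> A \<noteq> B"
proof -
  have "mat_rank (A - B) = 0 \<longleftrightarrow> A = B"
    using mat_rank_eq_0_iff[OF minus_carrier_mat[OF assms(2)], of A] minus_mat_eq_0_iff[OF assms]
    by simp
  moreover have "mat_near m n A B \<longleftrightarrow> mat_rank (A - B) \<le> 1"
    using mat_near_iff_rank[OF assms(2,1)] mat_near_sym by blast
  ultimately show ?thesis by (auto simp: adjacent_def)
qed

lemma rank_le_one_eq: "rank_le_one m n = {X. mat_near m n (0\<^sub>m m n) X}"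
proof -
  have "X - 0\<^sub>m m n = X" if "X \<in> carrier_mat m n" for X :: "'a mat"
    using that by (intro eq_matI) auto
  then have "mat_near m n (0\<^sub>m m n) X \<longleftrightarrow> mat_rank X \<le> 1" if "X \<in> carrier_mat m n" for X :: "'a mat"
    using mat_near_iff_rank[of "0\<^sub>m m n" m n X] that by simp
  then show ?thesis by (auto simp only: rank_le_one_def mat_near_def)
qed

lemma unit_ball_eq:
  fixes A :: "'a::division_ring mat"
  assumes A: "A \<in> carrier_mat m n"
  shows "unit_ball m n A = {X. mat_near m n A X}"
proof (rule equalityI; rule subsetI)
  fix X assume "X \<in> unit_ball m n A"
  then obtain Y where Y: "X = Y + A" "Y \<in> carrier_mat m n" "mat_near m n (0\<^sub>m m n) Y"
    by (auto simp: unit_ball_def rank_le_one_eq mat_near_def)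
  then obtain u v where "\<forall>i<m. \<forall>j<n. Y $$ (i, j) = 0\<^sub>m m n $$ (i, j) + u i * v j"
    unfolding mat_near_def by blast
  then show "X \<in> {X. mat_near m n A X}"
    using A Y by (auto intro!: mat_nearI[where u = u and v = v] simp: add.commute)
next
  fix X assume "X \<in> {X. mat_near m n A X}"
  then obtain u v where X: "X \<in> carrier_mat m n"
    and uv: "\<forall>i<m. \<forall>j<n. X $$ (i, j) = A $$ (i, j) + u i * v j"
    by (auto simp: mat_near_def)
  have "mat_near m n (0\<^sub>m m n) (X - A)"
    using X A uv by (intro mat_nearI[where u = u and v = v]) auto
  moreover have "X = (X - A) + A"
    using X A by (intro eq_matI) auto
  ultimately show "X \<in> unit_ball m n A"
    unfolding unit_ball_def rank_le_one_eq by blast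
qed

section \<open>Row lines and column lines\<close>

lemma row_line_self: "A \<in> carrier_mat m n \<Longrightarrow> A \<in> row_line m n u A"
  unfolding row_line_def by (auto intro!: exI[of _ "\<lambda>_. 0"])

lemma col_line_self: "A \<in> carrier_mat m n \<Longrightarrow> A \<in> col_line m n v A"
  unfolding col_line_def by (auto intro!: exI[of _ "\<lambda>_. 0"])

lemma row_lineI:
  assumes "X \<in> carrier_mat m n"
    and "\<And>i j. i < m \<Longrightarrow> j < n \<Longrightarrow> X $$ (i, j) = A $$ (i, j) + u i * y j"
  shows "X \<in> row_line m n u A"
  using assms unfolding row_line_def by blast

lemma col_lineI:
  assumes "X \<in> carrier_mat m n"
    and "\<And>i j. i < m \<Longrightarrow> j < n \<Longrightarrow> X $$ (i, j) = A $$ (i, j) + x i * v j"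
  shows "X \<in> col_line m n v A"
  using assms unfolding col_line_def by blast

lemma row_line_rebase:
  assumes "B \<in> row_line m n u A"
  shows "row_line m n u B = row_line m n u A"
proof -
  obtain y where y: "\<forall>i<m. \<forall>j<n. B $$ (i, j) = A $$ (i, j) + u i * y j"
    using assms unfolding row_line_def by blast
  show ?thesis
  proof (rule equalityI; rule subsetI)
    fix X assume "X \<in> row_line m n u B"
    then obtain z where "X \<in> carrier_mat m n" "\<forall>i<m. \<forall>j<n. X $$ (i, j) = B $$ (i, j) + u i * z j"
      unfolding row_line_def by blast
    with y show "X \<in> row_line m n u A"
      by (intro row_lineI[where y = "\<lambda>j. y j + z j"]) (auto simp: algebra_simps)
  next
    fix X assume "X \<in> row_line m n u A"
    then obtain z where "X \<in> carrier_mat m n" "\<forall>i<m. \<forall>j<n. X $$ (i, j) = A $$ (i, j) + u i * z j"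
      unfolding row_line_def by blast
    with y show "X \<in> row_line m n u B"
      by (intro row_lineI[where y = "\<lambda>j. z j - y j"]) (auto simp: algebra_simps)
  qed
qed

lemma col_line_rebase:
  assumes "B \<in> col_line m n v A"
  shows "col_line m n v B = col_line m n v A"
proof -
  obtain x where x: "\<forall>i<m. \<forall>j<n. B $$ (i, j) = A $$ (i, j) + x i * v j"
    using assms unfolding col_line_def by blast
  show ?thesis
  proof (rule equalityI; rule subsetI)
    fix X assume "X \<in> col_line m n v B"
    then obtain z where "X \<in> carrier_mat m n" "\<forall>i<m. \<forall>j<n. X $$ (i, j) = B $$ (i, j) + z i * v j"
      unfolding col_line_def by blast
    with x show "X \<in> col_line m n v A"
      by (intro col_lineI[where x = "\<lambda>j. x j + z j"]) (auto simp: algebra_simps)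
  next
    fix X assume "X \<in> col_line m n v A"
    then obtain z where "X \<in> carrier_mat m n" "\<forall>i<m. \<forall>j<n. X $$ (i, j) = A $$ (i, j) + z i * v j"
      unfolding col_line_def by blast
    with x show "X \<in> col_line m n v B"
      by (intro col_lineI[where x = "\<lambda>j. z j - x j"]) (auto simp: algebra_simps)
  qed
qed

lemma row_lines_through:
  assumes "L \<in> row_lines m n" "A \<in> L"
  obtains u where "L = row_line m n u A" "\<exists>i<m. u i \<noteq> 0"
  using assms row_line_rebase unfolding row_lines_def by blast

lemma col_lines_through:
  assumes "L \<in> col_lines m n" "A \<in> L"
  obtains v where "L = col_line m n v A" "\<exists>j<n. v j \<noteq> 0"
  using assms col_line_rebase unfolding col_lines_def by blast

text \<open>A right factor of \<open>u\<close> is absorbed into the free row. For column lines the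
  factor stands on the left of \<open>v\<close> and is absorbed into the free column.\<close>

lemma row_line_scale_subset:
  assumes "\<And>i. i < m \<Longrightarrow> u' i = u i * c"
  shows "row_line m n u' A \<subseteq> row_line m n u A"
proof
  fix X assume "X \<in> row_line m n u' A"
  then obtain y where "X \<in> carrier_mat m n" "\<forall>i<m. \<forall>j<n. X $$ (i, j) = A $$ (i, j) + u' i * y j"
    unfolding row_line_def by blast
  then show "X \<in> row_line m n u A"
    using assms by (intro row_lineI[where y = "\<lambda>j. c * y j"]) (auto simp: mult.assoc)
qed

lemma row_line_scale:
  assumes "\<And>i. i < m \<Longrightarrow> u' i = u i * c" and "\<exists>i<m. u' i \<noteq> 0"
  shows "row_line m n u' A = row_line m n u A"
proof
  have "c \<noteq> 0" using assms by auto
  then have "u i = u' i * inverse c" if "i < m" for i using assms(1)[OF that] by (simp add: mult.assoc)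
  then show "row_line m n u A \<subseteq> row_line m n u' A" by (rule row_line_scale_subset)
qed (use assms(1) in \<open>rule row_line_scale_subset\<close>)

lemma col_line_scale_subset:
  assumes "\<And>j. j < n \<Longrightarrow> v' j = c * v j"
  shows "col_line m n v' A \<subseteq> col_line m n v A"
proof
  fix X assume "X \<in> col_line m n v' A"
  then obtain x where "X \<in> carrier_mat m n" "\<forall>i<m. \<forall>j<n. X $$ (i, j) = A $$ (i, j) + x i * v' j"
    unfolding col_line_def by blast
  then show "X \<in> col_line m n v A"
    using assms by (intro col_lineI[where x = "\<lambda>i. x i * c"]) (auto simp: mult.assoc)
qed

lemma col_line_scale:
  assumes "\<And>j. j < n \<Longrightarrow> v' j = c * v j" and "\<exists>j<n. v' j \<noteq> 0"
  shows "col_line m n v' A = col_line m n v A"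
proof
  have "c \<noteq> 0" using assms by auto
  then have "v j = inverse c * v' j" if "j < n" for j
    using assms(1)[OF that] by (simp add: mult.assoc[symmetric])
  then show "col_line m n v A \<subseteq> col_line m n v' A" by (rule col_line_scale_subset)
qed (use assms(1) in \<open>rule col_line_scale_subset\<close>)

text \<open>Row \<open>i0\<close> expresses \<open>y\<close> through \<open>v\<close> and
  \<open>b\<close>. If \<open>w\<close> is not a right multiple of \<open>u\<close>, substituting
  this into a row \<open>i1\<close> where \<open>w - u * c\<close> is nonzero gives a relation
  between \<open>v\<close> and \<open>b\<close> alone: either \<open>v\<close> vanishes, or
  \<open>b\<close>, and with it \<open>y\<close>, is a left multiple of \<open>v\<close>.\<close>

lemma three_products_sum_0:
  fixes u w a y v b :: "nat \<Rightarrow> 'a::division_ring"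
  assumes sum: "\<And>i j. i < m \<Longrightarrow> j < n \<Longrightarrow> u i * y j + w i * v j + a i * b j = 0"
    and u: "\<exists>i<m. u i \<noteq> 0"
  shows "(\<exists>c. \<forall>i<m. w i = u i * c) \<or> (\<forall>j<n. v j = 0) \<or> (\<exists>c. \<forall>j<n. y j = c * v j)"
proof (rule ccontr)
  assume neg: "\<not> ?thesis"
  obtain i0 where i0: "i0 < m" "u i0 \<noteq> 0" using u by blast
  define c where "c = inverse (u i0) * w i0"
  define d where "d = inverse (u i0) * a i0"
  obtain i1 where i1: "i1 < m" "w i1 - u i1 * c \<noteq> 0" using neg by force
  have y: "y j = - c * v j - d * b j" if j: "j < n" for j
  proof -
    have "inverse (u i0) * (u i0 * y j + w i0 * v j + a i0 * b j) = 0"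
      using sum[OF i0(1) j] by simp
    moreover have "inverse (u i0) * (u i0 * y j + w i0 * v j + a i0 * b j) = y j + c * v j + d * b j"
      using i0 by (simp add: distrib_left mult.assoc[symmetric] c_def d_def)
    ultimately show ?thesis by (simp add: algebra_simps eq_neg_iff_add_eq_0)
  qed
  have row: "(w i1 - u i1 * c) * v j + (a i1 - u i1 * d) * b j = 0" if j: "j < n" for j
    using sum[OF i1(1) j] y[OF j] by (simp add: algebra_simps)
  show False
  proof (cases "a i1 - u i1 * d = 0")
    case True
    with row i1(2) neg show False by auto
  next
    case False
    define e where "e = - inverse (a i1 - u i1 * d) * (w i1 - u i1 * c)"
    have "b j = e * v j" if j: "j < n" for j
    proof -
      have "(a i1 - u i1 * d) * b j = - ((w i1 - u i1 * c) * v j)"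
        using row[OF j] by (simp add: eq_neg_iff_add_eq_0 add.commute)
      then have "inverse (a i1 - u i1 * d) * ((a i1 - u i1 * d) * b j)
          = - (inverse (a i1 - u i1 * d) * ((w i1 - u i1 * c) * v j))"
        by simp
      then show ?thesis
        unfolding mult.assoc[symmetric] e_def using False by simp
    qed
    with y have "\<forall>j<n. y j = (- c - d * e) * v j" by (simp add: algebra_simps)
    with neg show False by blast
  qed
qed

text \<open>Both \<open>span\<close> and \<open>cross\<close> reduce to
  \<open>three_products_sum_0\<close>: the differences along a closed triangle are three outer
  products with sum zero.\<close>

interpretation mat: adjacency_geometry "mat_near m n" "row_lines m n" "col_lines m n" for m n
proof unfold_locales
  show "mat_near m n X Y" if "L \<in> row_lines m n \<union> col_lines m n" "X \<in> L" "Y \<in> L"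
    for L and X Y :: "'a mat"
    using that(1)
  proof
    assume "L \<in> row_lines m n"
    from row_lines_through[OF this \<open>X \<in> L\<close>] obtain u where "L = row_line m n u X" by blast
    with that show ?thesis unfolding row_line_def mat_near_def by blast
  next
    assume "L \<in> col_lines m n"
    from col_lines_through[OF this \<open>X \<in> L\<close>] obtain v where "L = col_line m n v X" by blast
    with that show ?thesis unfolding col_line_def mat_near_def by blast
  qed
next
  fix p q :: "'a mat"
  assume "mat_near m n p q" and "p \<noteq> q"
  then obtain u y where pq: "p \<in> carrier_mat m n" "q \<in> carrier_mat m n"
    and q: "\<And>i j. i < m \<Longrightarrow> j < n \<Longrightarrow> q $$ (i, j) = p $$ (i, j) + u i * y j"
    unfolding mat_near_def by blast
  have "\<exists>i<m. \<exists>j<n. u i * y j \<noteq> 0"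
    using pq q \<open>p \<noteq> q\<close> eq_matI[of p q] by fastforce
  then have u: "\<exists>i<m. u i \<noteq> 0" and y: "\<exists>j<n. y j \<noteq> 0" by auto
  have nbrs: "x \<in> row_line m n u p \<union> col_line m n y p"
    if near: "mat_near m n x p" "mat_near m n x q" for x
  proof -
    obtain a b where x: "x \<in> carrier_mat m n"
      and ab: "\<And>i j. i < m \<Longrightarrow> j < n \<Longrightarrow> x $$ (i, j) = p $$ (i, j) + a i * b j"
      using mat_near_sym[OF near(1)] unfolding mat_near_def by blast
    obtain c d where cd: "\<And>i j. i < m \<Longrightarrow> j < n \<Longrightarrow> q $$ (i, j) = x $$ (i, j) + c i * d j"
      using near(2) unfolding mat_near_def by blast
    have "u i * y j + a i * (- b j) + c i * (- d j) = 0" if "i < m" "j < n" for i j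
      using q[OF that] ab[OF that] cd[OF that] by (simp add: algebra_simps)
    from three_products_sum_0[where u = u and y = y, OF this u]
    consider e where "\<forall>i<m. a i = u i * e" | "\<forall>j<n. - b j = 0" | e where "\<forall>j<n. y j = e * (- b j)"
      by blast
    then show ?thesis
    proof cases
      case 1
      then have "x \<in> row_line m n u p"
        using x ab by (intro row_lineI[where y = "\<lambda>j. e * b j"]) (auto simp: mult.assoc)
      then show ?thesis ..
    next
      case 2
      then have "x \<in> row_line m n u p"
        using x ab by (intro row_lineI[where y = "\<lambda>_. 0"]) auto
      then show ?thesis ..
    next
      case 3
      \<comment> \<open>Since \<open>y\<close> is nonzero, so is the factor, and the proportional
        rows \<open>y\<close> and \<open>b\<close> span the same column line.\<close>
      then have "col_line m n y p = col_line m n b p"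
        using y by (intro col_line_scale[where c = "- e"]) auto
      moreover have "x \<in> col_line m n b p"
        using x ab by (intro col_lineI) auto
      ultimately show ?thesis by blast
    qed
  qed
  have q_in: "q \<in> row_line m n u p" "q \<in> col_line m n y p"
    using pq q by (auto intro: row_lineI col_lineI)
  have lines: "row_line m n u p \<in> row_lines m n" "col_line m n y p \<in> col_lines m n"
    using pq u y unfolding row_lines_def col_lines_def by blast+
  show "\<exists>M\<in>row_lines m n. \<exists>N\<in>col_lines m n. p \<in> M \<inter> N \<and> q \<in> M \<inter> N \<and>
      (\<forall>x. mat_near m n x p \<longrightarrow> mat_near m n x q \<longrightarrow> x \<in> M \<union> N)"
    by (rule bexI[OF _ lines(1)], rule bexI[OF _ lines(2)])
      (use row_line_self[OF pq(1)] col_line_self[OF pq(1)] q_in nbrs in simp)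
next
  fix M M' and p q :: "'a mat"
  assume M: "M \<in> row_lines m n" "M' \<in> row_lines m n" "p \<in> M \<inter> M'" "q \<in> M \<inter> M'" "p \<noteq> q"
  obtain u where u: "M = row_line m n u p" "\<exists>i<m. u i \<noteq> 0" using row_lines_through M by blast
  obtain u' where u': "M' = row_line m n u' p" "\<exists>i<m. u' i \<noteq> 0" using row_lines_through M by blast
  have p_in: "p \<in> row_line m n u p" and q_in: "q \<in> row_line m n u p" "q \<in> row_line m n u' p"
    using M u(1) u'(1) by simp_all
  obtain y where y: "\<And>i j. i < m \<Longrightarrow> j < n \<Longrightarrow> q $$ (i, j) = p $$ (i, j) + u i * y j"
    using q_in(1) unfolding row_line_def by blast
  obtain y' where y': "\<And>i j. i < m \<Longrightarrow> j < n \<Longrightarrow> q $$ (i, j) = p $$ (i, j) + u' i * y' j"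
    using q_in(2) unfolding row_line_def by blast
  have eq: "u i * y j = u' i * y' j" if "i < m" "j < n" for i j
    using y[OF that] y'[OF that] by simp
  have "p \<in> carrier_mat m n" "q \<in> carrier_mat m n" using p_in q_in(1) unfolding row_line_def by blast+
  then obtain i j where ij: "i < m" "j < n" "u i * y j \<noteq> 0"
    using y \<open>p \<noteq> q\<close> eq_matI[of p q] by fastforce
  with eq[of i j] have "y' j \<noteq> 0" by auto
  \<comment> \<open>Comparing the two expressions for \<open>q - p\<close> in a column
    \<open>j\<close> where they do not vanish shows that \<open>u\<close> and \<open>u'\<close> are
    proportional from the right.\<close>
  then have "u' k = u k * (y j * inverse (y' j))" if "k < m" for k
    using eq[OF that ij(2)] by (simp add: mult.assoc[symmetric]) (simp add: mult.assoc)
  then show "M = M'"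
    using u u' row_line_scale[of m u' u] by metis
next
  fix N N' and p q :: "'a mat"
  assume N: "N \<in> col_lines m n" "N' \<in> col_lines m n" "p \<in> N \<inter> N'" "q \<in> N \<inter> N'" "p \<noteq> q"
  obtain v where v: "N = col_line m n v p" "\<exists>j<n. v j \<noteq> 0" using col_lines_through N by blast
  obtain v' where v': "N' = col_line m n v' p" "\<exists>j<n. v' j \<noteq> 0" using col_lines_through N by blast
  have p_in: "p \<in> col_line m n v p" and q_in: "q \<in> col_line m n v p" "q \<in> col_line m n v' p"
    using N v(1) v'(1) by simp_all
  obtain x where x: "\<And>i j. i < m \<Longrightarrow> j < n \<Longrightarrow> q $$ (i, j) = p $$ (i, j) + x i * v j"
    using q_in(1) unfolding col_line_def by blast
  obtain x' where x': "\<And>i j. i < m \<Longrightarrow> j < n \<Longrightarrow> q $$ (i, j) = p $$ (i, j) + x' i * v' j"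
    using q_in(2) unfolding col_line_def by blast
  have eq: "x i * v j = x' i * v' j" if "i < m" "j < n" for i j
    using x[OF that] x'[OF that] by simp
  have "p \<in> carrier_mat m n" "q \<in> carrier_mat m n" using p_in q_in(1) unfolding col_line_def by blast+
  then obtain i j where ij: "i < m" "j < n" "x i * v j \<noteq> 0"
    using x \<open>p \<noteq> q\<close> eq_matI[of p q] by fastforce
  with eq[of i j] have "x' i \<noteq> 0" by auto
  then have "v' k = (inverse (x' i) * x i) * v k" if "k < n" for k
    using eq[OF ij(1) that] by (simp add: mult.assoc) (simp add: mult.assoc[symmetric])
  then show "N = N'"
    using v v' col_line_scale[of n v' _ v] by metis
next
  fix M N and x z :: "'a mat"
  assume MN: "M \<in> row_lines m n" "N \<in> col_lines m n" "M \<inter> N \<noteq> {}" "x \<in> M - N" "z \<in> N - M"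
  then obtain p where p: "p \<in> M" "p \<in> N" by blast
  obtain u where u: "M = row_line m n u p" "\<exists>i<m. u i \<noteq> 0" using row_lines_through MN p by blast
  obtain v where v: "N = col_line m n v p" "\<exists>j<n. v j \<noteq> 0" using col_lines_through MN p by blast
  obtain y where y: "x \<in> carrier_mat m n"
    "\<And>i j. i < m \<Longrightarrow> j < n \<Longrightarrow> x $$ (i, j) = p $$ (i, j) + u i * y j"
    using MN(4) unfolding u(1) row_line_def by blast
  obtain w where w: "z \<in> carrier_mat m n"
    "\<And>i j. i < m \<Longrightarrow> j < n \<Longrightarrow> z $$ (i, j) = p $$ (i, j) + w i * v j"
    using MN(5) unfolding v(1) col_line_def by blast
  show "\<not> mat_near m n x z"
  proof
    assume "mat_near m n x z"
    then obtain a b where ab: "\<And>i j. i < m \<Longrightarrow> j < n \<Longrightarrow> z $$ (i, j) = x $$ (i, j) + a i * b j"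
      unfolding mat_near_def by blast
    have "u i * y j + (- w i) * v j + a i * b j = 0" if "i < m" "j < n" for i j
      using y(2)[OF that] w(2)[OF that] ab[OF that] by (simp add: algebra_simps)
    from three_products_sum_0[where u = u and y = y, OF this u(2)] v(2)
    consider e where "\<forall>i<m. - w i = u i * e" | e where "\<forall>j<n. y j = e * v j"
      by blast
    then show False
    proof cases
      case 1
      then have "w i = u i * - e" if "i < m" for i
        using that by (simp add: 1[rule_format, symmetric])
      then have "z \<in> M"
        unfolding u(1) using w by (intro row_lineI[where y = "\<lambda>j. - e * v j"]) (auto simp: mult.assoc)
      with MN show False by blast
    next
      case 2
      then have "x \<in> N"
        unfolding v(1) using y by (intro col_lineI[where x = "\<lambda>i. u i * e"]) (auto simp: mult.assoc)
      with MN show False by blast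
    qed
  qed
qed (rule mat_near_sym)

section \<open>Paths of near matrices\<close>

lemma relpowp_hom:
  assumes "(r ^^ k) x y" and "\<And>x y. r x y \<Longrightarrow> s (f x) (f y)"
  shows "(s ^^ k) (f x) (f y)"
  using assms(1)
proof (induction k arbitrary: y)
  case (Suc k)
  then obtain z where "(r ^^ k) x z" "r z y" by auto
  with Suc.IH assms(2) show ?case by (blast intro: relpowp_Suc_I)
qed simp

lemma relpowp_invariant:
  assumes "(r ^^ k) x y" and "P x" and "\<And>x y. P x \<Longrightarrow> r x y \<Longrightarrow> P y"
  shows "P y"
  using assms(1)
proof (induction k arbitrary: y)
  case (Suc k)
  then obtain z where "(r ^^ k) x z" "r z y" by auto
  with Suc.IH assms(3) show ?case by blast
qed (use assms(2) in simp)

text \<open>The rows in \<open>S\<close> are replaced one at a time, each replacement changing the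
  matrix by rank at most one.\<close>

lemma near_steps_rows:
  assumes "finite S" and "A \<in> carrier_mat m n" and "B \<in> carrier_mat m n"
    and "\<And>i j. i < m \<Longrightarrow> j < n \<Longrightarrow> i \<notin> S \<Longrightarrow> A $$ (i, j) = B $$ (i, j)"
  shows "(mat_near m n ^^ card S) A B"
  using assms(1,3,4)
proof (induction S arbitrary: B)
  case empty
  then have "A = B" using assms(2) by (intro eq_matI) auto
  then show ?case by simp
next
  case (insert k S)
  define B' where "B' = mat m n (\<lambda>(i, j). if i = k then A $$ (i, j) else B $$ (i, j))"
  have "(mat_near m n ^^ card S) A B'"
    using insert.prems by (intro insert.IH) (auto simp: B'_def)
  moreover have "mat_near m n B' B"
    using insert.prems(1)
    by (intro mat_nearI[where u = "\<lambda>i. if i = k then 1 else 0" and v = "\<lambda>j. B $$ (k, j) - A $$ (k, j)"])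
       (auto simp: B'_def)
  ultimately show ?case using insert.hyps by (auto intro: relpowp_Suc_I)
qed

lemma near_steps_cols:
  assumes "finite S" and "A \<in> carrier_mat m n" and "B \<in> carrier_mat m n"
    and "\<And>i j. i < m \<Longrightarrow> j < n \<Longrightarrow> j \<notin> S \<Longrightarrow> A $$ (i, j) = B $$ (i, j)"
  shows "(mat_near m n ^^ card S) A B"
  using assms(1,3,4)
proof (induction S arbitrary: B)
  case empty
  then have "A = B" using assms(2) by (intro eq_matI) auto
  then show ?case by simp
next
  case (insert k S)
  define B' where "B' = mat m n (\<lambda>(i, j). if j = k then A $$ (i, j) else B $$ (i, j))"
  have "(mat_near m n ^^ card S) A B'"
    using insert.prems by (intro insert.IH) (auto simp: B'_def)
  moreover have "mat_near m n B' B"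
    using insert.prems(1)
    by (intro mat_nearI[where v = "\<lambda>j. if j = k then 1 else 0" and u = "\<lambda>i. B $$ (i, k) - A $$ (i, k)"])
       (auto simp: B'_def)
  ultimately show ?case using insert.hyps by (auto intro: relpowp_Suc_I)
qed

lemma near_steps_sum:
  assumes "(mat_near m n ^^ k) A B"
  shows "\<exists>u v. \<forall>i<m. \<forall>j<n. B $$ (i, j) = A $$ (i, j) + (\<Sum>l<k. u l i * v l j)"
  using assms
proof (induction k arbitrary: B)
  case (Suc k)
  then obtain B' where B': "(mat_near m n ^^ k) A B'" "mat_near m n B' B" by auto
  obtain u v where uv: "\<forall>i<m. \<forall>j<n. B' $$ (i, j) = A $$ (i, j) + (\<Sum>l<k. u l i * v l j)"
    using Suc.IH[OF B'(1)] by blast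
  obtain x y where xy: "\<forall>i<m. \<forall>j<n. B $$ (i, j) = B' $$ (i, j) + x i * y j"
    using B'(2) unfolding mat_near_def by blast
  show ?case
    using uv xy by (intro exI[of _ "u(k := x)"] exI[of _ "v(k := y)"]) (auto simp: add.assoc)
qed simp

text \<open>A path of \<open>k\<close> steps adds \<open>k\<close> outer products, which bounds the
  rank by \<open>k\<close>. Both directions are stated because the zero matrix serves once as start
  and once as end.\<close>

lemma not_near_steps_0:
  assumes "A \<in> carrier_mat m n" and "k < mat_rank A"
  shows "\<not> (mat_near m n ^^ k) (0\<^sub>m m n) A" and "\<not> (mat_near m n ^^ k) A (0\<^sub>m m n)"
proof -
  show "\<not> (mat_near m n ^^ k) (0\<^sub>m m n) A"
  proof
    assume "(mat_near m n ^^ k) (0\<^sub>m m n) A"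
    then obtain u v where "\<forall>i<m. \<forall>j<n. A $$ (i, j) = 0\<^sub>m m n $$ (i, j) + (\<Sum>l<k. u l i * v l j)"
      using near_steps_sum by blast
    then have "mat_rank A \<le> k"
      by (intro mat_rank_le[OF assms(1), where u = u and v = v]) auto
    with assms(2) show False by simp
  qed
  show "\<not> (mat_near m n ^^ k) A (0\<^sub>m m n)"
  proof
    assume "(mat_near m n ^^ k) A (0\<^sub>m m n)"
    then obtain u v where "\<forall>i<m. \<forall>j<n. 0\<^sub>m m n $$ (i, j) = A $$ (i, j) + (\<Sum>l<k. u l i * v l j)"
      using near_steps_sum by blast
    then have "mat_rank A \<le> k"
      by (intro mat_rank_le[OF assms(1), where u = "\<lambda>l i. - u l i" and v = v])
         (auto simp: sum_negf eq_neg_iff_add_eq_0)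
    with assms(2) show False by simp
  qed
qed

section \<open>Meeting points, grids and links\<close>

lemma row_col_meet:
  assumes "L \<in> row_lines m n" "R \<in> col_lines m n" "A \<in> L \<inter> R"
  shows "\<exists>B\<in>L \<inter> R. B \<noteq> A"
proof -
  obtain u i where u: "L = row_line m n u A" "i < m" "u i \<noteq> 0"
    using row_lines_through assms by blast
  obtain v j where v: "R = col_line m n v A" "j < n" "v j \<noteq> 0"
    using col_lines_through assms by blast
  define B where "B = mat m n (\<lambda>(i, j). A $$ (i, j) + u i * v j)"
  have "B \<in> L \<inter> R"
    unfolding u(1) v(1) by (auto intro!: row_lineI col_lineI simp: B_def)
  moreover have "B $$ (i, j) \<noteq> A $$ (i, j)" using u v by (simp add: B_def)
  then have "B \<noteq> A" by auto
  ultimately show ?thesis by blast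
qed

text \<open>\<open>card\<close> is 0 on an infinite type, which is why having at least four elements
  is expressed by a disjunction.\<close>

lemma two_scalars_avoiding_0_1:
  assumes "infinite (UNIV :: 'a::division_ring set) \<or> card (UNIV :: 'a::division_ring set) \<ge> 4"
  obtains d e :: "'a::division_ring" where "d \<noteq> e" "d \<noteq> 0" "d \<noteq> 1" "e \<noteq> 0" "e \<noteq> 1"
proof -
  have *: "\<exists>x. x \<notin> S" if "card S \<le> 3" "finite S" for S :: "'a set"
  proof (rule ccontr)
    assume "\<nexists>x. x \<notin> S"
    then have "S = UNIV" by blast
    with that assms show False by auto
  qed
  obtain d :: 'a where "d \<notin> {0, 1}" using *[of "{0, 1}"] by auto
  moreover from this have "card {0, 1, d} = 3" by auto
  then obtain e :: 'a where "e \<notin> {0, 1, d}" using *[of "{0, 1, d}"] by auto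
  ultimately show ?thesis using that[of d e] by auto
qed

text \<open>
  With \<open>B = A + u y\<close> and \<open>X = B + w s\<close> the grid consists of \<open>P = A + u (y + s)\<close>,
  \<open>Q = A + (u + w d) y\<close> and \<open>T = A + (u + w d) e (y + s)\<close>, where \<open>e = (1 + d)\<^sup>-\<^sup>1\<close>; for instance,
  \<open>X - T = (u - w) ((1 - e) y - e s)\<close>.
\<close>
lemma mat_grid:
  fixes A B X :: "'a::division_ring mat"
  assumes large: "infinite (UNIV :: 'a set) \<or> card (UNIV :: 'a set) \<ge> 4"
    and L0: "L0 \<in> row_lines m n" and R0: "R0 \<in> col_lines m n"
    and A: "A \<in> L0 \<inter> R0" and B: "B \<in> L0 \<inter> R0" and "A \<noteq> B"
    and BX: "mat_near m n B X" and AX: "\<not> mat_near m n A X"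
  shows "\<exists>L\<in>row_lines m n. \<exists>L'\<in>row_lines m n. \<exists>R\<in>col_lines m n.
      \<exists>P\<in>L0 \<inter> R. \<exists>Q\<in>L \<inter> R0. \<exists>Q'\<in>L' \<inter> R0. \<exists>T\<in>L \<inter> R. \<exists>T'\<in>L' \<inter> R.
        A \<in> L \<inter> L' \<inter> R \<and> P \<noteq> B \<and> Q \<noteq> B \<and> Q' \<noteq> B \<and> T \<noteq> T' \<and> mat_near m n P X \<and>
        mat_near m n Q X \<and> mat_near m n Q' X \<and> mat_near m n T X \<and> mat_near m n T' X"
proof -
  obtain u where u: "L0 = row_line m n u A" "\<exists>i<m. u i \<noteq> 0"
    using row_lines_through L0 A by blast
  obtain y where y: "\<And>i j. i < m \<Longrightarrow> j < n \<Longrightarrow> B $$ (i, j) = A $$ (i, j) + u i * y j"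
    using B u unfolding row_line_def by blast
  have car: "A \<in> carrier_mat m n" "B \<in> carrier_mat m n" "X \<in> carrier_mat m n"
    using A B u BX unfolding row_line_def mat_near_def by blast+
  have y0: "\<exists>j<n. y j \<noteq> 0" using car y \<open>A \<noteq> B\<close> eq_matI[of A B] by fastforce
  \<comment> \<open>Only one column line passes through \<open>A\<close> and \<open>B\<close>, so
    \<open>R0\<close> must be the one with direction \<open>y\<close>.\<close>
  have "B \<in> col_line m n y A" using car y by (intro col_lineI) auto
  moreover have "col_line m n y A \<in> col_lines m n" using car y0 unfolding col_lines_def by blast
  ultimately have R0': "R0 = col_line m n y A"
    using mat.N_eq[OF R0, of _ A B] A B \<open>A \<noteq> B\<close> col_line_self[OF car(1)] by blast
  obtain w s where ws: "\<And>i j. i < m \<Longrightarrow> j < n \<Longrightarrow> X $$ (i, j) = B $$ (i, j) + w i * s j"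
    using BX unfolding mat_near_def by blast
  have X: "X $$ (i, j) = A $$ (i, j) + u i * y j + w i * s j" if "i < m" "j < n" for i j
    using y ws that by simp
  \<comment> \<open>As \<open>A\<close> and \<open>X\<close> are not near, \<open>u y + w s\<close>
    is not an outer product. Each of the following nonvanishing facts holds because its failure
    would make it one.\<close>
  have far: False if "\<And>i j. i < m \<Longrightarrow> j < n \<Longrightarrow> u i * y j + w i * s j = a i * b j" for a b
    using AX that car X by (auto intro!: mat_nearI[where u = a and v = b] simp: add.assoc)
  have s0: "\<exists>j<n. s j \<noteq> 0" using far[of u y] by auto
  have w0: "\<exists>i<m. w i \<noteq> 0" using far[of u y] by auto
  have uw: "\<exists>i<m. u i \<noteq> w i"
  proof (rule ccontr)
    assume "\<not> ?thesis"
    then show False using far[of u "\<lambda>j. y j + s j"] by (simp add: distrib_left)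
  qed
  have ys: "\<exists>j<n. y j + s j \<noteq> 0"
  proof (rule ccontr)
    assume "\<not> ?thesis"
    then have "y j = - s j" if "j < n" for j using that by (simp add: eq_neg_iff_add_eq_0)
    then show False using far[of "\<lambda>i. w i - u i" s] by (simp add: left_diff_distrib)
  qed
  define D where "D d i = u i + w i * d" for d i
  have D0: "\<exists>i<m. D d i \<noteq> 0" for d
  proof (rule ccontr)
    assume "\<not> ?thesis"
    then have "u i = - (w i * d)" if "i < m" for i
      using that by (simp add: D_def eq_neg_iff_add_eq_0)
    then show False using far[of w "\<lambda>j. s j - d * y j"] by (simp add: algebra_simps)
  qed
  define R where "R = col_line m n (\<lambda>j. y j + s j) A"
  define L where "L d = row_line m n (D d) A" for d
  define P where "P = mat m n (\<lambda>(i, j). A $$ (i, j) + u i * (y j + s j))"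
  define Q where "Q d = mat m n (\<lambda>(i, j). A $$ (i, j) + D d i * y j)" for d
  define T where "T d e = mat m n (\<lambda>(i, j). A $$ (i, j) + D d i * e * (y j + s j))" for d e
  have lines: "R \<in> col_lines m n" "L d \<in> row_lines m n" "A \<in> R" "A \<in> L d" for d
    using ys D0 car(1) row_line_self[OF car(1)] col_line_self[OF car(1)]
    unfolding R_def L_def row_lines_def col_lines_def by blast+
  have P: "P \<in> L0" "P \<in> R"
    unfolding u(1) R_def by (auto intro!: row_lineI col_lineI simp: P_def)
  have Q: "Q d \<in> L d" "Q d \<in> R0" for d
    unfolding L_def R0' by (auto intro!: row_lineI col_lineI simp: Q_def)
  have T: "T d e \<in> L d" "T d e \<in> R" for d e
    unfolding L_def R_def
    by (auto intro!: row_lineI[where y = "\<lambda>j. e * (y j + s j)"] col_lineI[where x = "\<lambda>i. D d i * e"]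
        simp: T_def mult.assoc)
  have PX: "mat_near m n P X"
    using car X by (intro mat_nearI[where u = "\<lambda>i. w i - u i" and v = s]) (auto simp: P_def algebra_simps)
  have QX: "mat_near m n (Q d) X" for d
    using car X by (intro mat_nearI[where u = w and v = "\<lambda>j. s j - d * y j"])
      (auto simp: Q_def D_def algebra_simps)
  \<comment> \<open>The condition says \<open>(1 + d) * e = 1\<close> and is kept in the form in
    which \<open>d\<close> can be eliminated.\<close>
  have DE: "D d i * e = u i * e + w i * (1 - e)" if "d * e = 1 - e" for d e i
    using that by (simp add: D_def distrib_right mult.assoc)
  have TX: "mat_near m n (T d e) X" if "d * e = 1 - e" for d e
    using car X by (intro mat_nearI[where u = "\<lambda>i. u i - w i" and v = "\<lambda>j. (1 - e) * y j - e * s j"])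
      (auto simp: T_def DE[OF that] algebra_simps)
  obtain i0 j0 where ij0: "i0 < m" "u i0 \<noteq> 0" "j0 < n" "s j0 \<noteq> 0" using u s0 by blast
  have "P $$ (i0, j0) \<noteq> B $$ (i0, j0)" using ij0 y by (simp add: P_def distrib_left)
  then have PB: "P \<noteq> B" by auto
  obtain i1 j1 where ij1: "i1 < m" "w i1 \<noteq> 0" "j1 < n" "y j1 \<noteq> 0" using w0 y0 by blast
  have QB: "Q d \<noteq> B" if "d \<noteq> 0" for d
  proof -
    have "Q d $$ (i1, j1) \<noteq> B $$ (i1, j1)" using ij1 y that by (simp add: Q_def D_def distrib_right)
    then show ?thesis by auto
  qed
  obtain i2 j2 where ij2: "i2 < m" "u i2 \<noteq> w i2" "j2 < n" "y j2 + s j2 \<noteq> 0" using uw ys by blast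
  have TT: "T d e \<noteq> T d' e'" if "d * e = 1 - e" "d' * e' = 1 - e'" "e \<noteq> e'" for d e d' e'
  proof
    assume "T d e = T d' e'"
    then have "T d e $$ (i2, j2) = T d' e' $$ (i2, j2)" by simp
    then have "u i2 * e + w i2 * (1 - e) = u i2 * e' + w i2 * (1 - e')"
      using ij2 by (simp add: T_def DE that(1,2))
    then have "(u i2 - w i2) * (e - e') = 0" by (simp add: algebra_simps)
    with ij2 that(3) show False by simp
  qed
  \<comment> \<open>\<open>e\<close> must be nonzero to define \<open>d\<close>, and different from
    1 to make \<open>d\<close> nonzero, which keeps \<open>Q d\<close> apart from
    \<open>B\<close>.\<close>
  obtain e e' :: 'a where e: "e \<noteq> e'" "e \<noteq> 0" "e \<noteq> 1" "e' \<noteq> 0" "e' \<noteq> 1"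
    using two_scalars_avoiding_0_1[OF large] by blast
  define d where "d = inverse e - 1"
  define d' where "d' = inverse e' - 1"
  have de: "d * e = 1 - e" "d' * e' = 1 - e'"
    using e by (simp_all add: d_def d'_def left_diff_distrib)
  with e have "d \<noteq> 0" "d' \<noteq> 0" by auto
  show ?thesis
    by (rule bexI[of _ "L d"], rule bexI[of _ "L d'"], rule bexI[of _ R], rule bexI[of _ P],
        rule bexI[of _ "Q d"], rule bexI[of _ "Q d'"], rule bexI[of _ "T d e"],
        rule bexI[of _ "T d' e'"])
      (simp_all add: lines P Q T PX QX TX[OF de(1)] TX[OF de(2)] PB QB TT[OF de] e
        \<open>d \<noteq> 0\<close> \<open>d' \<noteq> 0\<close>)
qed

text \<open>
  If \<open>u\<close> and \<open>u'\<close> are independent, \<open>X = A + u y + u' y'\<close> can be chosen to agree with \<open>C\<close> in two rows,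
  so that \<open>C\<close> is reached from \<open>X\<close> in \<open>m - 2\<close> steps.
\<close>
lemma row_link:
  fixes A C :: "'a::division_ring mat"
  assumes hom: "\<And>X Y. mat_near m n X Y \<Longrightarrow> mat_near m' n' (\<phi> X) (\<phi> Y)"
    and A: "A \<in> carrier_mat m n" and C: "C \<in> carrier_mat m n"
    and steps: "\<not> (mat_near m' n' ^^ (m - 1)) (\<phi> A) (\<phi> C)"
    and L: "L \<in> row_lines m n" "L' \<in> row_lines m n" "A \<in> L" "A \<in> L'" "L \<noteq> L'"
  shows "\<exists>X. \<exists>R\<in>col_lines m n. \<exists>B\<in>L \<inter> R. \<exists>B'\<in>L' \<inter> R. A \<in> R \<and> B \<noteq> A \<and> B' \<noteq> A \<and>
      mat_near m n B X \<and> mat_near m n B' X \<and> \<not> mat_near m' n' (\<phi> A) (\<phi> X)"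
proof -
  obtain u where u: "L = row_line m n u A" "\<exists>i<m. u i \<noteq> 0" using row_lines_through L by blast
  obtain u' where u': "L' = row_line m n u' A" "\<exists>i<m. u' i \<noteq> 0" using row_lines_through L by blast
  obtain i where i: "i < m" "u i \<noteq> 0" using u by blast
  \<comment> \<open>Subtracting \<open>u * c\<close> from \<open>u'\<close> clears row
    \<open>i\<close>; as the lines differ, some row \<open>k\<close> of the remainder
    \<open>r\<close> is nonzero.\<close>
  define c where "c = inverse (u i) * u' i"
  define r where "r k = u' k - u k * c" for k
  have ri: "r i = 0" using i by (simp add: r_def c_def mult.assoc[symmetric])
  obtain k where k: "k < m" "r k \<noteq> 0"
    using row_line_scale[where u = u and c = c, OF _ u'(2)] L(5) u u' unfolding r_def by auto
  have "i \<noteq> k" using ri k by blast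
  \<comment> \<open>A triangular system: \<open>y1\<close> adjusts row \<open>i\<close> to
    \<open>C\<close>, then \<open>y'\<close> adjusts row \<open>k\<close> without disturbing row
    \<open>i\<close>. Rewriting \<open>u y1 + r y'\<close> as \<open>u y + u' y'\<close> determines
    \<open>y\<close>.\<close>
  define y1 where "y1 l = inverse (u i) * (C $$ (i, l) - A $$ (i, l))" for l
  define y' where "y' l = inverse (r k) * (C $$ (k, l) - A $$ (k, l) - u k * y1 l)" for l
  define y where "y l = y1 l - c * y' l" for l
  define X where "X = mat m n (\<lambda>(p, l). A $$ (p, l) + u p * y l + u' p * y' l)"
  have X': "X $$ (p, l) = A $$ (p, l) + u p * y1 l + r p * y' l" if "p < m" "l < n" for p l
    using that by (simp add: X_def y_def r_def algebra_simps)
  have uy: "u i * y1 l = C $$ (i, l) - A $$ (i, l)" for l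
    using i by (simp add: y1_def mult.assoc[symmetric])
  have ry: "r k * y' l = C $$ (k, l) - A $$ (k, l) - u k * y1 l" for l
    using k by (simp add: y'_def mult.assoc[symmetric])
  have XC: "X $$ (p, l) = C $$ (p, l)" if "p < m" "l < n" "p \<notin> {..<m} - {i, k}" for p l
  proof -
    from that have "p = i \<or> p = k" by auto
    then show ?thesis using X'[OF that(1,2)] by (auto simp: uy ry ri)
  qed
  have Xc: "X \<in> carrier_mat m n" by (simp add: X_def)
  have far: "\<not> mat_near m' n' (\<phi> A) (\<phi> X)"
  proof
    assume "mat_near m' n' (\<phi> A) (\<phi> X)"
    moreover have "(mat_near m n ^^ card ({..<m} - {i, k})) X C"
      by (rule near_steps_rows[OF _ Xc C XC]) auto
    then have "(mat_near m' n' ^^ card ({..<m} - {i, k})) (\<phi> X) (\<phi> C)"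
      by (rule relpowp_hom[where r = "mat_near m n" and f = \<phi>]) (rule hom)
    ultimately have "(mat_near m' n' ^^ Suc (card ({..<m} - {i, k}))) (\<phi> A) (\<phi> C)"
      by (rule relpowp_Suc_I2)
    moreover have "Suc (card ({..<m} - {i, k})) = m - 1"
      using i k \<open>i \<noteq> k\<close> by (simp add: card_Diff_subset)
    ultimately show False using steps by simp
  qed
  \<comment> \<open>If \<open>u y + u' y'\<close> were an outer product, \<open>X\<close> would be
    near \<open>A\<close>, and so would their images.\<close>
  have far': False if "\<And>p l. p < m \<Longrightarrow> l < n \<Longrightarrow> u p * y l + u' p * y' l = a p * b l" for a b
    using far hom[OF mat_nearI[OF A Xc, where u = a and v = b]] that by (simp add: X_def add.assoc)
  have yy': "\<exists>l<n. y l + y' l \<noteq> 0"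
  proof (rule ccontr)
    assume "\<not> ?thesis"
    then have "y l = - y' l" if "l < n" for l using that by (simp add: eq_neg_iff_add_eq_0)
    then show False using far'[of "\<lambda>p. u' p - u p" y'] by (simp add: left_diff_distrib)
  qed
  \<comment> \<open>The joining line has direction \<open>y + y'\<close>, because
    \<open>X - B = (u' - u) y'\<close> and \<open>X - B' = (u - u') y\<close>.\<close>
  define R where "R = col_line m n (\<lambda>l. y l + y' l) A"
  define B where "B = mat m n (\<lambda>(p, l). A $$ (p, l) + u p * (y l + y' l))"
  define B' where "B' = mat m n (\<lambda>(p, l). A $$ (p, l) + u' p * (y l + y' l))"
  have "R \<in> col_lines m n" "A \<in> R"
    using yy' A col_line_self[OF A] unfolding R_def col_lines_def by blast+
  moreover have "B \<in> L" "B \<in> R" "B' \<in> L'" "B' \<in> R"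
    unfolding R_def u(1) u'(1) by (auto intro!: row_lineI col_lineI simp: B_def B'_def)
  moreover have "mat_near m n B X"
    using Xc by (intro mat_nearI[where u = "\<lambda>p. u' p - u p" and v = y'])
      (auto simp: B_def X_def algebra_simps)
  moreover have "mat_near m n B' X"
    using Xc by (intro mat_nearI[where u = "\<lambda>p. u p - u' p" and v = y])
      (auto simp: B'_def X_def algebra_simps)
  moreover obtain l where l: "l < n" "y l + y' l \<noteq> 0" using yy' by blast
  have "B $$ (i, l) \<noteq> A $$ (i, l)" using i l by (simp add: B_def)
  then have "B \<noteq> A" by auto
  moreover obtain i' where i': "i' < m" "u' i' \<noteq> 0" using u' by blast
  have "B' $$ (i', l) \<noteq> A $$ (i', l)" using i' l by (simp add: B'_def)
  then have "B' \<noteq> A" by auto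
  ultimately show ?thesis using far by blast
qed

text \<open>The mirror image of \<open>row_link\<close>, with scalars on the other side:
  \<open>X\<close> is made to agree with \<open>C\<close> in two columns. Transposition does not
  preserve outer products over a noncommutative ring, so the computation is carried out
  again.\<close>

lemma col_link:
  fixes A C :: "'a::division_ring mat"
  assumes hom: "\<And>X Y. mat_near m n X Y \<Longrightarrow> mat_near m' n' (\<phi> X) (\<phi> Y)"
    and A: "A \<in> carrier_mat m n" and C: "C \<in> carrier_mat m n"
    and steps: "\<not> (mat_near m' n' ^^ (n - 1)) (\<phi> A) (\<phi> C)"
    and R: "R \<in> col_lines m n" "R' \<in> col_lines m n" "A \<in> R" "A \<in> R'" "R \<noteq> R'"
  shows "\<exists>X. \<exists>L\<in>row_lines m n. \<exists>B\<in>R \<inter> L. \<exists>B'\<in>R' \<inter> L. A \<in> L \<and> B \<noteq> A \<and> B' \<noteq> A \<and>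
      mat_near m n B X \<and> mat_near m n B' X \<and> \<not> mat_near m' n' (\<phi> A) (\<phi> X)"
proof -
  obtain v where v: "R = col_line m n v A" "\<exists>j<n. v j \<noteq> 0" using col_lines_through R by blast
  obtain v' where v': "R' = col_line m n v' A" "\<exists>j<n. v' j \<noteq> 0" using col_lines_through R by blast
  obtain j where j: "j < n" "v j \<noteq> 0" using v by blast
  define c where "c = v' j * inverse (v j)"
  define r where "r k = v' k - c * v k" for k
  have rj: "r j = 0" using j by (simp add: r_def c_def mult.assoc)
  obtain k where k: "k < n" "r k \<noteq> 0"
    using col_line_scale[where v = v and c = c, OF _ v'(2)] R(5) v v' unfolding r_def by auto
  have "j \<noteq> k" using rj k by blast
  define x1 where "x1 p = (C $$ (p, j) - A $$ (p, j)) * inverse (v j)" for p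
  define x' where "x' p = (C $$ (p, k) - A $$ (p, k) - x1 p * v k) * inverse (r k)" for p
  define x where "x p = x1 p - x' p * c" for p
  define X where "X = mat m n (\<lambda>(p, l). A $$ (p, l) + x p * v l + x' p * v' l)"
  have X': "X $$ (p, l) = A $$ (p, l) + x1 p * v l + x' p * r l" if "p < m" "l < n" for p l
    using that by (simp add: X_def x_def r_def algebra_simps)
  have xv: "x1 p * v j = C $$ (p, j) - A $$ (p, j)" for p
    using j by (simp add: x1_def mult.assoc)
  have xr: "x' p * r k = C $$ (p, k) - A $$ (p, k) - x1 p * v k" for p
    using k by (simp add: x'_def mult.assoc)
  have XC: "X $$ (p, l) = C $$ (p, l)" if "p < m" "l < n" "l \<notin> {..<n} - {j, k}" for p l
  proof -
    from that have "l = j \<or> l = k" by auto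
    then show ?thesis using X'[OF that(1,2)] by (auto simp: xv xr rj)
  qed
  have Xc: "X \<in> carrier_mat m n" by (simp add: X_def)
  have far: "\<not> mat_near m' n' (\<phi> A) (\<phi> X)"
  proof
    assume "mat_near m' n' (\<phi> A) (\<phi> X)"
    moreover have "(mat_near m n ^^ card ({..<n} - {j, k})) X C"
      by (rule near_steps_cols[OF _ Xc C XC]) auto
    then have "(mat_near m' n' ^^ card ({..<n} - {j, k})) (\<phi> X) (\<phi> C)"
      by (rule relpowp_hom[where r = "mat_near m n" and f = \<phi>]) (rule hom)
    ultimately have "(mat_near m' n' ^^ Suc (card ({..<n} - {j, k}))) (\<phi> A) (\<phi> C)"
      by (rule relpowp_Suc_I2)
    moreover have "Suc (card ({..<n} - {j, k})) = n - 1"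
      using j k \<open>j \<noteq> k\<close> by (simp add: card_Diff_subset)
    ultimately show False using steps by simp
  qed
  have far': False if "\<And>p l. p < m \<Longrightarrow> l < n \<Longrightarrow> x p * v l + x' p * v' l = a p * b l" for a b
    using far hom[OF mat_nearI[OF A Xc, where u = a and v = b]] that by (simp add: X_def add.assoc)
  have xx': "\<exists>p<m. x p + x' p \<noteq> 0"
  proof (rule ccontr)
    assume "\<not> ?thesis"
    then have "x p = - x' p" if "p < m" for p using that by (simp add: eq_neg_iff_add_eq_0)
    then show False using far'[of x' "\<lambda>l. v' l - v l"] by (simp add: right_diff_distrib)
  qed
  define L where "L = row_line m n (\<lambda>p. x p + x' p) A"
  define B where "B = mat m n (\<lambda>(p, l). A $$ (p, l) + (x p + x' p) * v l)"
  define B' where "B' = mat m n (\<lambda>(p, l). A $$ (p, l) + (x p + x' p) * v' l)"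
  have "L \<in> row_lines m n" "A \<in> L"
    using xx' A row_line_self[OF A] unfolding L_def row_lines_def by blast+
  moreover have "B \<in> R" "B \<in> L" "B' \<in> R'" "B' \<in> L"
    unfolding L_def v(1) v'(1) by (auto intro!: row_lineI col_lineI simp: B_def B'_def)
  moreover have "mat_near m n B X"
    using Xc by (intro mat_nearI[where u = x' and v = "\<lambda>l. v' l - v l"])
      (auto simp: B_def X_def algebra_simps)
  moreover have "mat_near m n B' X"
    using Xc by (intro mat_nearI[where u = x and v = "\<lambda>l. v l - v' l"])
      (auto simp: B'_def X_def algebra_simps)
  moreover obtain p where p: "p < m" "x p + x' p \<noteq> 0" using xx' by blast
  have "B $$ (p, j) \<noteq> A $$ (p, j)" using j p by (simp add: B_def)
  then have "B \<noteq> A" by auto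
  moreover obtain j' where j': "j' < n" "v' j' \<noteq> 0" using v' by blast
  have "B' $$ (p, j') \<noteq> A $$ (p, j')" using j' p by (simp add: B'_def)
  then have "B' \<noteq> A" by auto
  ultimately show ?thesis using far by blast
qed

section \<open>From maximal sets and graph homomorphisms to the geometry\<close>

lemma type_one_row_line:
  fixes S :: "'a::division_ring mat set"
  assumes "type_one m n S" and "0 < m"
  shows "S \<in> row_lines m n"
proof -
  obtain P A where P: "P \<in> carrier_mat m m" "invertible_mat P" and A: "A \<in> carrier_mat m n"
    and S: "S = {P * X + A | X. X \<in> first_row_mats m n}"
    using assms(1) by (auto simp: type_one_def GL_def)
  \<comment> \<open>Only the first row of \<open>X\<close> is nonzero, so \<open>P * X\<close> is
    the first column of \<open>P\<close> times that row.\<close>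
  define u where "u i = P $$ (i, 0)" for i
  have entry: "(P * X + A) $$ (i, j) = A $$ (i, j) + u i * X $$ (0, j)"
    if "X \<in> first_row_mats m n" "i < m" "j < n" for X i j
  proof -
    have X: "X \<in> carrier_mat m n" using that by (simp add: first_row_mats_def)
    have "(P * X) $$ (i, j) = (\<Sum>k<m. P $$ (i, k) * X $$ (k, j))"
      using P X that by (simp add: scalar_prod_def atLeast0LessThan)
    also have "\<dots> = (\<Sum>k<m. if k = 0 then P $$ (i, 0) * X $$ (0, j) else 0)"
      using that by (intro sum.cong) (auto simp: first_row_mats_def)
    also have "\<dots> = u i * X $$ (0, j)" using \<open>0 < m\<close> by (simp add: u_def)
    finally show ?thesis using P X A that by (simp add: add.commute)
  qed
  have "S = row_line m n u A"
  proof (rule equalityI; rule subsetI)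
    fix Z assume "Z \<in> S"
    then obtain X where X: "Z = P * X + A" "X \<in> first_row_mats m n" unfolding S by blast
    then show "Z \<in> row_line m n u A"
      using P A entry[OF X(2)] by (intro row_lineI) (auto simp: first_row_mats_def)
  next
    fix Z assume "Z \<in> row_line m n u A"
    then obtain y where y: "Z \<in> carrier_mat m n" "\<forall>i<m. \<forall>j<n. Z $$ (i, j) = A $$ (i, j) + u i * y j"
      unfolding row_line_def by blast
    define X where "X = mat m n (\<lambda>(i, j). if i = 0 then y j else 0)"
    have X: "X \<in> first_row_mats m n" by (auto simp: X_def first_row_mats_def)
    have "Z = P * X + A"
      using y P A X entry[OF X] \<open>0 < m\<close> by (intro eq_matI) (auto simp: X_def)
    with X show "Z \<in> S" unfolding S by blast
  qed
  \<comment> \<open>A zero first column of \<open>P\<close> would make the entry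
    \<open>(0, 0)\<close> of \<open>Q * P\<close> vanish for an inverse \<open>Q\<close>.\<close>
  moreover have "\<exists>i<m. u i \<noteq> 0"
  proof (rule ccontr)
    assume u0: "\<not> ?thesis"
    obtain Q where Q: "Q * P = 1\<^sub>m (dim_row Q)" "P * Q = 1\<^sub>m (dim_row P)"
      using P(2) unfolding invertible_mat_def inverts_mat_def by auto
    \<comment> \<open>\<open>invertible_mat\<close> leaves the dimensions of \<open>Q\<close> open;
      they follow from the two products being identity matrices.\<close>
    have "dim_col (Q * P) = dim_row Q" unfolding Q(1) by simp
    then have "dim_row Q = m" using P by simp
    moreover have "dim_col Q = m"
      using arg_cong[OF Q(2), of dim_col] P by simp
    ultimately have "(Q * P) $$ (0, 0) = (\<Sum>k<m. Q $$ (0, k) * P $$ (k, 0))"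
      using P \<open>0 < m\<close> by (simp add: scalar_prod_def atLeast0LessThan)
    also have "\<dots> = 0" using u0 by (intro sum.neutral) (auto simp: u_def)
    finally show False using Q(1) \<open>dim_row Q = m\<close> \<open>0 < m\<close> by simp
  qed
  ultimately show ?thesis using A unfolding row_lines_def by blast
qed

text \<open>Here the direction \<open>v\<close> is the first row of the invertible factor.\<close>

lemma type_two_col_line:
  fixes S :: "'a::division_ring mat set"
  assumes "type_two m n S" and "0 < n"
  shows "S \<in> col_lines m n"
proof -
  obtain P A where P: "P \<in> carrier_mat n n" "invertible_mat P" and A: "A \<in> carrier_mat m n"
    and S: "S = {X * P + A | X. X \<in> first_col_mats m n}"
    using assms(1) by (auto simp: type_two_def GL_def)
  define v where "v j = P $$ (0, j)" for j
  have entry: "(X * P + A) $$ (i, j) = A $$ (i, j) + X $$ (i, 0) * v j"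
    if "X \<in> first_col_mats m n" "i < m" "j < n" for X i j
  proof -
    have X: "X \<in> carrier_mat m n" using that by (simp add: first_col_mats_def)
    have "(X * P) $$ (i, j) = (\<Sum>k<n. X $$ (i, k) * P $$ (k, j))"
      using P X that by (simp add: scalar_prod_def atLeast0LessThan)
    also have "\<dots> = (\<Sum>k<n. if k = 0 then X $$ (i, 0) * P $$ (0, j) else 0)"
      using that by (intro sum.cong) (auto simp: first_col_mats_def)
    also have "\<dots> = X $$ (i, 0) * v j" using \<open>0 < n\<close> by (simp add: v_def)
    finally show ?thesis using P X A that by (simp add: add.commute)
  qed
  have "S = col_line m n v A"
  proof (rule equalityI; rule subsetI)
    fix Z assume "Z \<in> S"
    then obtain X where X: "Z = X * P + A" "X \<in> first_col_mats m n" unfolding S by blast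
    then show "Z \<in> col_line m n v A"
      using P A entry[OF X(2)] by (intro col_lineI) (auto simp: first_col_mats_def)
  next
    fix Z assume "Z \<in> col_line m n v A"
    then obtain x where x: "Z \<in> carrier_mat m n" "\<forall>i<m. \<forall>j<n. Z $$ (i, j) = A $$ (i, j) + x i * v j"
      unfolding col_line_def by blast
    define X where "X = mat m n (\<lambda>(i, j). if j = 0 then x i else 0)"
    have X: "X \<in> first_col_mats m n" by (auto simp: X_def first_col_mats_def)
    have "Z = X * P + A"
      using x P A X entry[OF X] \<open>0 < n\<close> by (intro eq_matI) (auto simp: X_def)
    with X show "Z \<in> S" unfolding S by blast
  qed
  moreover have "\<exists>j<n. v j \<noteq> 0"
  proof (rule ccontr)
    assume v0: "\<not> ?thesis"
    obtain Q where Q: "P * Q = 1\<^sub>m (dim_row P)" "Q * P = 1\<^sub>m (dim_row Q)"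
      using P(2) unfolding invertible_mat_def inverts_mat_def by auto
    have "dim_col (Q * P) = dim_row Q" unfolding Q(2) by simp
    then have "dim_row Q = n" using P by simp
    moreover have "dim_col Q = n"
      using arg_cong[OF Q(1), of dim_col] P by simp
    ultimately have "(P * Q) $$ (0, 0) = (\<Sum>k<n. P $$ (0, k) * Q $$ (k, 0))"
      using P \<open>0 < n\<close> by (simp add: scalar_prod_def atLeast0LessThan)
    also have "\<dots> = 0" using v0 by (intro sum.neutral) (auto simp: v_def)
    finally show False using Q(1) P \<open>0 < n\<close> by simp
  qed
  ultimately show ?thesis using A unfolding col_lines_def by blast
qed

text \<open>Adjacency is nearness of distinct matrices, so distinct near matrices keep distinct near
  images, and equal ones cause no trouble.\<close>

lemma graph_hom_near:
  assumes "graph_hom m n m' n' \<phi>" and "mat_near m n X Y"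
  shows "mat_near m' n' (\<phi> X) (\<phi> Y)" and "X \<noteq> Y \<Longrightarrow> \<phi> X \<noteq> \<phi> Y"
proof -
  have car: "X \<in> carrier_mat m n" "Y \<in> carrier_mat m n"
    using assms(2) by (auto simp: mat_near_def)
  then have car': "\<phi> X \<in> carrier_mat m' n'" "\<phi> Y \<in> carrier_mat m' n'"
    using assms(1) by (auto simp: graph_hom_def)
  have adj: "mat_near m' n' (\<phi> X) (\<phi> Y) \<and> \<phi> X \<noteq> \<phi> Y" if "X \<noteq> Y"
  proof -
    have "adjacent X Y" using adjacent_iff[OF car] assms(2) that by blast
    then have "adjacent (\<phi> X) (\<phi> Y)" using assms(1) car by (auto simp: graph_hom_def)
    then show ?thesis using adjacent_iff[OF car'] by blast
  qed
  then show "X \<noteq> Y \<Longrightarrow> \<phi> X \<noteq> \<phi> Y" by blast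
  from adj show "mat_near m' n' (\<phi> X) (\<phi> Y)" using mat_near_refl[OF car'(1)] by (cases "X = Y") auto
qed

theorem theorem5p1:
  fixes m n m' n' :: nat
    and \<phi> :: "'a::division_ring mat \<Rightarrow> 'b::division_ring mat"
    and A\<^sub>0 :: "'a mat"
  assumes "infinite (UNIV :: 'a set) \<or> card (UNIV :: 'a set) \<ge> 4"
    and "m \<ge> 2" and "n \<ge> 2" and "m' \<ge> 2" and "n' \<ge> 2"
    and "m' \<ge> min m n" and "n' \<ge> min m n"
    and "graph_hom m n m' n' \<phi>"
    and "degenerate m n m' n' \<phi>"
    and "\<phi> (0\<^sub>m m n) = 0\<^sub>m m' n'"
    and "A\<^sub>0 \<in> carrier_mat m n"
    and "mat_rank (\<phi> A\<^sub>0) = min m n"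
  shows "adjacent_set m' n' (\<phi> ` rank_le_one m n) \<and> adjacent_set m' n' (\<phi> ` unit_ball m n A\<^sub>0)"
proof -
  have near: "mat_near m' n' (\<phi> X) (\<phi> Y)" if "mat_near m n X Y" for X Y
    using graph_hom_near(1)[OF assms(8) that] .
  have inj: "\<phi> X \<noteq> \<phi> Y" if "mat_near m n X Y" "X \<noteq> Y" for X Y
    using graph_hom_near(2)[OF assms(8) that] .
  interpret adjacency_hom "mat_near m n" "row_lines m n" "col_lines m n"
    "mat_near m' n'" "row_lines m' n'" "col_lines m' n'" \<phi>
  proof unfold_locales
    show "\<exists>B\<in>L \<inter> R. B \<noteq> A"
      if "L \<in> row_lines m n" "R \<in> col_lines m n" "A \<in> L \<inter> R" for L R A
      using row_col_meet that by blast
  qed (fact near, fact inj, rule mat_grid[OF assms(1)])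
  \<comment> \<open>Stated for an arbitrary centre \<open>A\<close> and a far partner
    \<open>C\<close>, to be applied to the zero matrix and \<open>A\<^sub>0\<close> in both
    orders.\<close>
  have in_one_set: "adjacent_set m' n' (\<phi> ` unit_ball m n A)"
    if A: "A \<in> carrier_mat m n" and C: "C \<in> carrier_mat m n" "\<not> (mat_near m' n' ^^ (min m n - 1)) (\<phi> A) (\<phi> C)"
    for A C
  proof -
    \<comment> \<open>The smaller dimension decides: the step bound is \<open>m - 1\<close> or
      \<open>n - 1\<close>, as required by \<open>row_link\<close> or
      \<open>col_link\<close>.\<close>
    have "row_linked A \<or> col_linked A"
    proof (cases "m \<le> n")
      case True
      then have "row_linked A"
        unfolding row_linked_def using row_link[where \<phi> = \<phi>, OF near A C(1)] C(2) by (simp add: min_def)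
      then show ?thesis ..
    next
      case False
      then have "col_linked A"
        unfolding col_linked_def using col_link[where \<phi> = \<phi>, OF near A C(1)] C(2) by (simp add: min_def)
      then show ?thesis ..
    qed
    moreover obtain B K N where B: "B \<in> carrier_mat m n" "collapses B K N"
    proof -
      obtain B K N where B: "B \<in> rank_le_one m n"
        and types: "type_one m' n' K \<and> type_two m' n' N \<or> type_two m' n' K \<and> type_one m' n' N"
        and im: "\<phi> ` unit_ball m n B \<subseteq> K \<union> N" "\<phi> B \<in> K \<inter> N"
        using assms(9) unfolding degenerate_def by blast
      have Bc: "B \<in> carrier_mat m n" using B by (simp add: rank_le_one_def)
      \<comment> \<open>Degeneracy allows the two types in either order, whereas
        \<open>collapses\<close> expects the row line first.\<close>
      from types show ?thesis
      proof
        assume "type_one m' n' K \<and> type_two m' n' N"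
        then have "K \<in> row_lines m' n'" "N \<in> col_lines m' n'"
          using assms(4,5) by (auto intro!: type_one_row_line type_two_col_line)
        with im have "collapses B K N" by (simp add: collapses_def unit_ball_eq[OF Bc])
        with Bc that show ?thesis by blast
      next
        assume "type_two m' n' K \<and> type_one m' n' N"
        then have "N \<in> row_lines m' n'" "K \<in> col_lines m' n'"
          using assms(4,5) by (auto intro!: type_one_row_line type_two_col_line)
        with im have "collapses B N K" by (simp add: collapses_def unit_ball_eq[OF Bc] Un_commute)
        with Bc that show ?thesis by blast
      qed
    qed
    \<comment> \<open>Any two matrices are joined by replacing all \<open>m\<close> rows in turn, so
      collapsing spreads from \<open>B\<close> to \<open>A\<close>.\<close>
    moreover have "(mat_near m n ^^ m) B A"
      using near_steps_rows[OF _ B(1) A, of "{..<m}"] by simp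
    then have "\<exists>K N. collapses A K N"
    proof (rule relpowp_invariant)
      show "\<exists>K N. collapses B K N" using B by blast
    qed (rule collapses_near)
    ultimately obtain K where K: "K \<in> row_lines m' n' \<union> col_lines m' n'"
      and im: "\<phi> ` {X. mat_near m n A X} \<subseteq> K"
      using ball_image_in_one_set unfolding collapses_def by (metis UnCI)
    have "adjacent_set m' n' (\<phi> ` {X. mat_near m n A X})"
      unfolding adjacent_set_def
    proof (intro conjI ballI impI)
      show "\<phi> ` {X. mat_near m n A X} \<noteq> {}" using mat_near_refl[OF A] by blast
      show "\<phi> ` {X. mat_near m n A X} \<subseteq> carrier_mat m' n'"
        using near by (auto simp: mat_near_def)
      show "adjacent X Y"
        if "X \<in> \<phi> ` {X. mat_near m n A X}" "Y \<in> \<phi> ` {X. mat_near m n A X}" "X \<noteq> Y" for X Y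
      proof -
        have "mat_near m' n' X Y" using mat.clique[OF K] im that by blast
        moreover from this have "X \<in> carrier_mat m' n'" "Y \<in> carrier_mat m' n'"
          by (auto simp: mat_near_def)
        ultimately show ?thesis using adjacent_iff that(3) by blast
      qed
    qed
    then show ?thesis using unit_ball_eq[OF A] by simp
  qed
  have \<phi>A: "\<phi> A\<^sub>0 \<in> carrier_mat m' n'"
    using assms(8,11) by (auto simp: graph_hom_def)
  have zero: "(0\<^sub>m m n :: 'a mat) \<in> carrier_mat m n" by simp
  \<comment> \<open>Strict because \<open>min m n\<close> is positive, so the natural subtraction
    does not truncate.\<close>
  have rank: "min m n - 1 < mat_rank (\<phi> A\<^sub>0)"
    unfolding assms(12) using assms(2,3) by linarith
  have "adjacent_set m' n' (\<phi> ` unit_ball m n (0\<^sub>m m n))"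
    using in_one_set[OF zero assms(11)] not_near_steps_0(1)[OF \<phi>A rank] assms(10) by simp
  moreover have "unit_ball m n (0\<^sub>m m n :: 'a mat) = rank_le_one m n"
    unfolding unit_ball_eq[OF zero] rank_le_one_eq ..
  moreover have "adjacent_set m' n' (\<phi> ` unit_ball m n A\<^sub>0)"
    using in_one_set[OF assms(11) zero] not_near_steps_0(2)[OF \<phi>A rank] assms(10) by simp
  ultimately show ?thesis by simp
qed

end
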